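(* Let $G$ and $H$ be CSA$^\ast$-groups, let $A$ be a subgroup of $G$ and $B$ a subgroup of $H$ such that $A=\mathrm{mal}_G(A)$ and $B$ is a normal subgroup of $\mathrm{mal}_H(B)$, and let $\phi:A\to B$ be an isomorphism. Then the amalgamated product $G\ast_\phi H$ is a CSA$^\ast$-group.
   Context: Notation: $H^x=x^{-1}Hx$. A subgroup $K$ of a group $G$ is malnormal if $K\cap K^x=1$ for all $x\in G\setminus K$. Intersections of malnormal subgroups are malnormal; the malnormal closure $\mathrm{mal}_G(A)$ of a subgroup $A\le G$ is the intersection of all malnormal subgroups of $G$ containing $A$. A group is a CSA-group if all its maximal abelian subgroups are malnormal. A CSA$^\ast$-group is a CSA-group without elements of order 2. $G\ast_\phi H$ denotes the free product of $G$ and $H$ with $a$ identified with $\phi(a)$ for all $a\in A$. *)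

theory Defs
  imports "HOL-Algebra.Multiplicative_Group"
begin

section \<open>Malnormal subgroups and CSA-groups\<close>

definition conj_set :: "('a, 'm) monoid_scheme \<Rightarrow> 'a set \<Rightarrow> 'a \<Rightarrow> 'a set" where
  "conj_set G K x = inv\<^bsub>G\<^esub> x <#\<^bsub>G\<^esub> (K #>\<^bsub>G\<^esub> x)"

definition malnormal :: "'a set \<Rightarrow> ('a, 'm) monoid_scheme \<Rightarrow> bool" where
  "malnormal K G \<longleftrightarrow>
     subgroup K G \<and> (\<forall>x \<in> carrier G - K. K \<inter> conj_set G K x = {\<one>\<^bsub>G\<^esub>})"

definition mal_closure :: "('a, 'm) monoid_scheme \<Rightarrow> 'a set \<Rightarrow> 'a set" where
  "mal_closure G A = \<Inter>{K. malnormal K G \<and> A \<subseteq> K}"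

definition abelian_subgroup :: "'a set \<Rightarrow> ('a, 'm) monoid_scheme \<Rightarrow> bool" where
  "abelian_subgroup M G \<longleftrightarrow> subgroup M G \<and> comm_group (G\<lparr>carrier := M\<rparr>)"

definition maximal_abelian_subgroup :: "'a set \<Rightarrow> ('a, 'm) monoid_scheme \<Rightarrow> bool" where
  "maximal_abelian_subgroup M G \<longleftrightarrow>
     abelian_subgroup M G \<and> (\<forall>N. abelian_subgroup N G \<longrightarrow> M \<subseteq> N \<longrightarrow> N = M)"

definition CSA_group :: "('a, 'm) monoid_scheme \<Rightarrow> bool" where
  "CSA_group G \<longleftrightarrow> group G \<and> (\<forall>M. maximal_abelian_subgroup M G \<longrightarrow> malnormal M G)"

definition CSA_star_group :: "('a, 'm) monoid_scheme \<Rightarrow> bool" where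
  "CSA_star_group G \<longleftrightarrow> CSA_group G \<and> (\<forall>x \<in> carrier G. group.ord G x \<noteq> 2)"


section \<open>Amalgamated products\<close>

text \<open>
  The product of \<open>G\<close> and \<open>H\<close> amalgamated along \<open>\<phi>\<close> is presented by the generators
  \<open>carrier G <+> carrier H\<close>, the multiplication tables of \<open>G\<close> and \<open>H\<close>, and the
  identifications \<open>a = \<phi> a\<close> for \<open>a \<in> A\<close>. Every generator has its inverse (taken in \<open>G\<close> or
  \<open>H\<close>) among the generators, so finite words without formal inverses suffice: the monoid
  so presented is already a group.
\<close>

definition amalg_words :: "('a, 'm) monoid_scheme \<Rightarrow> ('b, 'n) monoid_scheme \<Rightarrow> ('a + 'b) list set" where
  "amalg_words G H = lists (carrier G <+> carrier H)"

inductive_set amalg_rel ::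
  "('a, 'm) monoid_scheme \<Rightarrow> ('b, 'n) monoid_scheme \<Rightarrow> 'a set \<Rightarrow> ('a \<Rightarrow> 'b) \<Rightarrow>
     (('a + 'b) list \<times> ('a + 'b) list) set"
  for G H A \<phi> where
  refl: "u \<in> amalg_words G H \<Longrightarrow> (u, u) \<in> amalg_rel G H A \<phi>"
| sym: "(u, v) \<in> amalg_rel G H A \<phi> \<Longrightarrow> (v, u) \<in> amalg_rel G H A \<phi>"
| trans: "(u, v) \<in> amalg_rel G H A \<phi> \<Longrightarrow> (v, w) \<in> amalg_rel G H A \<phi> \<Longrightarrow> (u, w) \<in> amalg_rel G H A \<phi>"
| append: "(u, u') \<in> amalg_rel G H A \<phi> \<Longrightarrow> (v, v') \<in> amalg_rel G H A \<phi> \<Longrightarrow>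
    (u @ v, u' @ v') \<in> amalg_rel G H A \<phi>"
| one_left: "([Inl \<one>\<^bsub>G\<^esub>], []) \<in> amalg_rel G H A \<phi>"
| one_right: "([Inr \<one>\<^bsub>H\<^esub>], []) \<in> amalg_rel G H A \<phi>"
| mult_left: "x \<in> carrier G \<Longrightarrow> y \<in> carrier G \<Longrightarrow>
    ([Inl x, Inl y], [Inl (x \<otimes>\<^bsub>G\<^esub> y)]) \<in> amalg_rel G H A \<phi>"
| mult_right: "x \<in> carrier H \<Longrightarrow> y \<in> carrier H \<Longrightarrow>
    ([Inr x, Inr y], [Inr (x \<otimes>\<^bsub>H\<^esub> y)]) \<in> amalg_rel G H A \<phi>"
| amalg: "a \<in> A \<Longrightarrow> ([Inl a], [Inr (\<phi> a)]) \<in> amalg_rel G H A \<phi>"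

definition amalgamated_product ::
  "('a, 'm) monoid_scheme \<Rightarrow> ('b, 'n) monoid_scheme \<Rightarrow> 'a set \<Rightarrow> ('a \<Rightarrow> 'b) \<Rightarrow>
     ('a + 'b) list set monoid" where
  "amalgamated_product G H A \<phi> =
     \<lparr>carrier = amalg_words G H // amalg_rel G H A \<phi>,
      mult = (\<lambda>U V. \<Union>u\<in>U. \<Union>v\<in>V. amalg_rel G H A \<phi> `` {u @ v}),
      one = amalg_rel G H A \<phi> `` {[]}\<rparr>"

end

theory Submission
  imports Defs
begin

text \<open>
  The amalgamated product \<open>P\<close> of \<open>G\<close> and \<open>H\<close> acts on its Bass-Serre tree, whose vertices are the
  cosets of \<open>G\<close> and \<open>H\<close> and whose edges are the cosets of the common subgroup \<open>C\<close>. Being an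
  intersection of malnormal subgroups, \<open>C\<close> is malnormal in \<open>G\<close>, so two different
  edges at a vertex of type \<open>G\<close> have stabilisers that intersect trivially. This is the geometric
  reason for everything below, although the argument is phrased with reduced words and never
  mentions the tree formally.

  A group is a CSA-group if and only if, for every \<open>a \<noteq> 1\<close>, the centraliser of \<open>a\<close> is abelian and
  every \<open>g\<close> for which \<open>a\<close> commutes with its conjugate by \<open>g\<close> commutes with \<open>a\<close>
  (\<open>CSA_group_imp_csa_at\<close>, \<open>CSA_group_if_csa_at\<close>). This condition is invariant under
  conjugation of \<open>a\<close>, and every element of \<open>P\<close> is conjugate either into a factor or to a cyclically
  reduced word of positive even length (\<open>cyclic_reduction\<close>).

  If \<open>a\<close> is conjugate into a factor, it fixes a vertex. A nontrivial element fixes at most one vertex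
  of type \<open>H\<close> (\<open>F_False_malnormal\<close>), and if it fixes none, at most one of type \<open>G\<close>
  (\<open>F_True_malnormal_outside_conjugates_of_C\<close>). Everything that the condition speaks about then lies
  in the stabiliser of that vertex, that is, in a conjugate of \<open>G\<close> or \<open>H\<close>, where it is known to hold
  (\<open>csa_at_in_factor\<close>).

  If \<open>a\<close> is a cyclically reduced word, it translates a line in the tree. The elements commuting with
  \<open>a\<close> translate one end of this line along itself (\<open>centraliser_shifts\<close>), and only the identity does
  so by 0 (\<open>shifts_0_imp_one\<close>). Hence the centraliser of \<open>a\<close> is infinite cyclic, and an element that
  normalises it either centralises it or inverts it. In the latter case it would have order 2,
  but \<open>P\<close> has no such elements because \<open>G\<close> and \<open>H\<close> have none (\<open>no_involution\<close>).

  That reduced words behave as expected in the group defined by generators and relations is the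
  normal form theorem, proved by van der Waerden's method: the group acts on the set of normal
  forms (\<open>rel_acts\<close>, \<open>reduced_acts\<close>).
\<close>

section \<open>An elementwise form of the CSA property\<close>

definition commute :: "('a, 'm) monoid_scheme \<Rightarrow> 'a \<Rightarrow> 'a \<Rightarrow> bool" where
  "commute G x y \<longleftrightarrow> x \<otimes>\<^bsub>G\<^esub> y = y \<otimes>\<^bsub>G\<^esub> x"

text \<open>The CSA property, one nontrivial element \<open>a\<close> at a time: commutation is transitive through
  \<open>a\<close>, and \<open>a\<close> does not commute with a conjugate of itself by an element outside its
  centraliser. The set \<open>S\<close> to which the quantifiers are relativised makes it possible to
  speak of a factor inside the ambient group without changing the multiplication.\<close>

definition csa_at :: "('a, 'm) monoid_scheme \<Rightarrow> 'a set \<Rightarrow> 'a \<Rightarrow> bool" where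
  "csa_at G S a \<longleftrightarrow>
     (\<forall>x\<in>S. \<forall>y\<in>S. commute G a x \<longrightarrow> commute G a y \<longrightarrow> commute G x y) \<and>
     (\<forall>g\<in>S. commute G a (g \<otimes>\<^bsub>G\<^esub> (a \<otimes>\<^bsub>G\<^esub> inv\<^bsub>G\<^esub> g)) \<longrightarrow> commute G a g)"

context group
begin

lemma inv_cancel_left [simp]:
  assumes "x \<in> carrier G" "y \<in> carrier G"
  shows "inv x \<otimes> (x \<otimes> y) = y" "x \<otimes> (inv x \<otimes> y) = y"
  using assms by (simp_all flip: m_assoc)

lemma conj_eq_one_iff:
  assumes "x \<in> carrier G" "a \<in> carrier G"
  shows "x \<otimes> (a \<otimes> inv x) = \<one> \<longleftrightarrow> a = \<one>"
proof
  assume "x \<otimes> (a \<otimes> inv x) = \<one>"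
  then have "inv x \<otimes> ((x \<otimes> (a \<otimes> inv x)) \<otimes> x) = \<one>" using assms by simp
  then show "a = \<one>" using assms by (simp add: m_assoc)
qed (use assms in simp)

lemma commute_iff_conj:
  assumes "x \<in> carrier G" "a \<in> carrier G"
  shows "commute G a x \<longleftrightarrow> x \<otimes> (a \<otimes> inv x) = a"
proof
  assume "commute G a x"
  then have "x \<otimes> a = a \<otimes> x" by (simp add: commute_def)
  then have "(x \<otimes> a) \<otimes> inv x = (a \<otimes> x) \<otimes> inv x" by simp
  then show "x \<otimes> (a \<otimes> inv x) = a" using assms by (simp add: m_assoc)
next
  assume "x \<otimes> (a \<otimes> inv x) = a"
  then have "(x \<otimes> (a \<otimes> inv x)) \<otimes> x = a \<otimes> x" by simp
  then show "commute G a x" using assms by (simp add: m_assoc commute_def)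
qed

lemma commute_mult:
  assumes "x \<in> carrier G" "y \<in> carrier G" "z \<in> carrier G" "commute G x z" "commute G y z"
  shows "commute G (x \<otimes> y) z"
proof -
  have "x \<otimes> (y \<otimes> z) = x \<otimes> (z \<otimes> y)" using assms(5) by (simp add: commute_def)
  also have "\<dots> = (x \<otimes> z) \<otimes> y" using assms(1-3) by (simp add: m_assoc)
  also have "\<dots> = z \<otimes> (x \<otimes> y)" using assms(1-4) by (simp add: commute_def m_assoc)
  finally show ?thesis using assms(1-3) by (simp add: commute_def m_assoc)
qed

lemma commute_inv:
  assumes "x \<in> carrier G" "z \<in> carrier G" "commute G x z"
  shows "commute G (inv x) z"
proof -
  have "inv x \<otimes> ((x \<otimes> z) \<otimes> inv x) = inv x \<otimes> ((z \<otimes> x) \<otimes> inv x)"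
    using assms(3) by (simp add: commute_def)
  then show ?thesis using assms(1,2) by (simp add: commute_def m_assoc)
qed

lemma commute_sym: "commute G x y \<Longrightarrow> commute G y x"
  by (simp add: commute_def)

text \<open>A subset that is maximal among the pairwise commuting ones is its own centraliser, hence
  closed under the group operations; this is what lets Zorn's lemma run over plain subsets.\<close>

lemma commuting_set_in_maximal_abelian_subgroup:
  assumes "S \<subseteq> carrier G" "\<And>x y. x \<in> S \<Longrightarrow> y \<in> S \<Longrightarrow> commute G x y"
  shows "\<exists>M. maximal_abelian_subgroup M G \<and> S \<subseteq> M"
proof -
  define \<F> where "\<F> = {T. S \<subseteq> T \<and> T \<subseteq> carrier G \<and> (\<forall>x\<in>T. \<forall>y\<in>T. commute G x y)}"
  have "\<exists>M\<in>\<F>. \<forall>X\<in>\<F>. M \<subseteq> X \<longrightarrow> X = M"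
  proof (rule subset_Zorn_nonempty)
    show "\<F> \<noteq> {}" using assms unfolding \<F>_def by blast
    show "\<Union>\<C> \<in> \<F>" if "\<C> \<noteq> {}" "subset.chain \<F> \<C>" for \<C>
    proof -
      have *: "T \<in> \<F>" if "T \<in> \<C>" for T using that \<open>subset.chain \<F> \<C>\<close> by (auto simp: subset_chain_def)
      have "commute G x y" if xy: "x \<in> \<Union>\<C>" "y \<in> \<Union>\<C>" for x y
      proof -
        obtain T U where TU: "T \<in> \<C>" "U \<in> \<C>" "x \<in> T" "y \<in> U" using xy by blast
        then have "T \<subseteq> U \<or> U \<subseteq> T" using \<open>subset.chain \<F> \<C>\<close> by (auto simp: subset_chain_def)
        then show ?thesis using TU * unfolding \<F>_def by blast
      qed
      moreover have "S \<subseteq> \<Union>\<C>" "\<Union>\<C> \<subseteq> carrier G" using * \<open>\<C> \<noteq> {}\<close> unfolding \<F>_def by blast+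
      ultimately show ?thesis unfolding \<F>_def by blast
    qed
  qed
  then obtain M where M: "M \<in> \<F>" and max: "\<And>X. X \<in> \<F> \<Longrightarrow> M \<subseteq> X \<Longrightarrow> X = M" by blast
  have Mc: "M \<subseteq> carrier G" and Mcomm: "\<And>x y. x \<in> M \<Longrightarrow> y \<in> M \<Longrightarrow> commute G x y"
    and SM: "S \<subseteq> M"
    using M unfolding \<F>_def by auto
  have self_centralising: "z \<in> M" if "z \<in> carrier G" "\<And>x. x \<in> M \<Longrightarrow> commute G z x" for z
  proof -
    have "insert z M \<in> \<F>" using that Mc Mcomm SM commute_sym
      unfolding \<F>_def by (auto simp: commute_def)
    then show ?thesis using max by blast
  qed
  have sub: "subgroup M G"
  proof
    show "M \<subseteq> carrier G" by (rule Mc)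
    show "x \<otimes> y \<in> M" if "x \<in> M" "y \<in> M" for x y
      by (rule self_centralising) (use that Mc Mcomm in \<open>auto intro!: commute_mult\<close>)
    show "\<one> \<in> M" by (rule self_centralising) (use Mc in \<open>auto simp: commute_def\<close>)
    show "inv x \<in> M" if "x \<in> M" for x
      by (rule self_centralising) (use that Mc Mcomm in \<open>auto intro!: commute_inv\<close>)
  qed
  have "comm_group (G\<lparr>carrier := M\<rparr>)"
    by (rule group.group_comm_groupI)
      (use subgroup.subgroup_is_group[OF sub is_group] Mcomm in \<open>auto simp: commute_def\<close>)
  moreover have "N = M" if "abelian_subgroup N G" "M \<subseteq> N" for N
  proof -
    have "N \<subseteq> carrier G" using that(1) by (simp add: abelian_subgroup_def subgroup_def)
    moreover have "commute G x y" if "x \<in> N" "y \<in> N" for x y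
    proof -
      interpret N: comm_group "G\<lparr>carrier := N\<rparr>"
        using \<open>abelian_subgroup N G\<close> by (simp add: abelian_subgroup_def)
      show ?thesis using N.m_comm that by (simp add: commute_def)
    qed
    ultimately have "N \<in> \<F>" using SM that(2) unfolding \<F>_def by blast
    then show ?thesis using max that(2) by blast
  qed
  ultimately show ?thesis using sub SM
    unfolding maximal_abelian_subgroup_def abelian_subgroup_def by blast
qed

lemma mem_conj_set_iff:
  assumes "K \<subseteq> carrier G" "x \<in> carrier G"
  shows "b \<in> conj_set G K x \<longleftrightarrow> (\<exists>k\<in>K. b = inv x \<otimes> (k \<otimes> x))"
  unfolding conj_set_def l_coset_def r_coset_def by auto

lemma malnormalD:
  assumes "malnormal K G" "x \<in> carrier G" "k \<in> K" "inv x \<otimes> (k \<otimes> x) \<in> K" "k \<noteq> \<one>"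
  shows "x \<in> K"
proof (rule ccontr)
  assume "x \<notin> K"
  have K: "K \<subseteq> carrier G" using assms(1) by (simp add: malnormal_def subgroup_def)
  have "inv x \<otimes> (k \<otimes> x) = \<one>"
    using \<open>x \<notin> K\<close> assms mem_conj_set_iff[OF K, of x] unfolding malnormal_def by blast
  then show False using conj_eq_one_iff[of "inv x" k] assms K by auto
qed

lemma malnormalI:
  assumes "subgroup K G"
    "\<And>x k. x \<in> carrier G \<Longrightarrow> k \<in> K \<Longrightarrow> inv x \<otimes> (k \<otimes> x) \<in> K \<Longrightarrow> k \<noteq> \<one> \<Longrightarrow> x \<in> K"
  shows "malnormal K G"
  unfolding malnormal_def
proof (intro conjI ballI)
  have K: "K \<subseteq> carrier G" "\<one> \<in> K" using assms(1) by (auto simp: subgroup_def)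
  fix x assume x: "x \<in> carrier G - K"
  have "\<one> \<in> conj_set G K x" using K x mem_conj_set_iff[OF K(1), of x \<one>] by force
  moreover have "b = \<one>" if b: "b \<in> K \<inter> conj_set G K x" for b
  proof -
    obtain k where k: "k \<in> K" "b = inv x \<otimes> (k \<otimes> x)"
      using b x mem_conj_set_iff[OF K(1), of x b] by blast
    then have "k = \<one>" using assms(2)[of x k] b x by blast
    then show ?thesis using k x by simp
  qed
  ultimately show "K \<inter> conj_set G K x = {\<one>}" using K by blast
qed (rule assms(1))

text \<open>A maximal abelian subgroup \<open>M\<close> containing \<open>a\<close> contains the whole centraliser of \<open>a\<close>:
  if \<open>x\<close> centralises \<open>a\<close>, then \<open>a\<close> is a nontrivial element of \<open>M\<close> and of its conjugate
  by \<open>x\<close>. Malnormality is used once more for the conjugate of \<open>a\<close> that commutes with \<open>a\<close>.\<close>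

lemma CSA_group_imp_csa_at:
  assumes "CSA_group G" "a \<in> carrier G" "a \<noteq> \<one>"
  shows "csa_at G (carrier G) a"
proof -
  obtain M where M: "maximal_abelian_subgroup M G" "a \<in> M"
    using commuting_set_in_maximal_abelian_subgroup[of "{a}"] assms by (auto simp: commute_def)
  have mal: "malnormal M G" using assms(1) M by (simp add: CSA_group_def)
  have Mc: "M \<subseteq> carrier G" using mal by (simp add: malnormal_def subgroup_def)
  have comm: "commute G x y" if "x \<in> M" "y \<in> M" for x y
  proof -
    interpret M: comm_group "G\<lparr>carrier := M\<rparr>"
      using M(1) by (simp add: maximal_abelian_subgroup_def abelian_subgroup_def)
    show ?thesis using M.m_comm that by (simp add: commute_def)
  qed
  have centraliser: "x \<in> M" if "x \<in> carrier G" "commute G a x" for x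
  proof (rule malnormalD[OF mal that(1) M(2) _ assms(3)])
    show "inv x \<otimes> (a \<otimes> x) \<in> M" using that assms(2) M(2) by (simp add: commute_def)
  qed
  have "commute G a g"
    if g: "g \<in> carrier G" and c: "commute G a (g \<otimes> (a \<otimes> inv g))" for g
  proof -
    have b: "g \<otimes> (a \<otimes> inv g) \<in> M" using centraliser g c assms(2) by simp
    have "inv g \<in> M"
      by (rule malnormalD[OF mal _ M(2) _ assms(3)]) (use b g in simp_all)
    then have "g \<in> M" using mal g by (metis inv_inv malnormal_def subgroup.m_inv_closed)
    then show ?thesis using comm M(2) by simp
  qed
  then show ?thesis using comm centraliser by (auto simp: csa_at_def)
qed

text \<open>If \<open>k\<close> and its conjugate by \<open>x\<close> are nontrivial elements of the maximal abelian subgroup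
  \<open>M\<close>, they commute, so \<open>x\<close> commutes with \<open>k\<close> and, by transitivity, with all of \<open>M\<close>; by
  maximality \<open>x\<close> lies in \<open>M\<close>.\<close>

lemma CSA_group_if_csa_at:
  assumes "\<And>a. a \<in> carrier G \<Longrightarrow> a \<noteq> \<one> \<Longrightarrow> csa_at G (carrier G) a"
  shows "CSA_group G"
  unfolding CSA_group_def
proof (intro conjI allI impI)
  fix M assume M: "maximal_abelian_subgroup M G"
  then have sub: "subgroup M G" by (simp add: maximal_abelian_subgroup_def abelian_subgroup_def)
  then have Mc: "M \<subseteq> carrier G" by (simp add: subgroup_def)
  have comm: "commute G x y" if "x \<in> M" "y \<in> M" for x y
  proof -
    interpret M: comm_group "G\<lparr>carrier := M\<rparr>"
      using M by (simp add: maximal_abelian_subgroup_def abelian_subgroup_def)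
    show ?thesis using M.m_comm that by (simp add: commute_def)
  qed
  show "malnormal M G"
  proof (rule malnormalI[OF sub])
    fix x k assume x: "x \<in> carrier G" and k: "k \<in> M" "inv x \<otimes> (k \<otimes> x) \<in> M" "k \<noteq> \<one>"
    have csa: "csa_at G (carrier G) k" using assms k Mc by blast
    have "commute G k (inv x \<otimes> (k \<otimes> inv (inv x)))" using comm[OF k(1,2)] x by simp
    then have "commute G k (inv x)" using csa x by (auto simp: csa_at_def)
    then have kx: "commute G k x" using commute_inv[of "inv x" k] commute_sym x k Mc by auto
    then have "commute G x y" if "y \<in> M" for y
      using csa comm[OF k(1) that] that x Mc unfolding csa_at_def by blast
    then have "\<And>y z. y \<in> insert x M \<Longrightarrow> z \<in> insert x M \<Longrightarrow> commute G y z"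
      using comm commute_sym by (auto simp: commute_def)
    then obtain N where "maximal_abelian_subgroup N G" "insert x M \<subseteq> N"
      using commuting_set_in_maximal_abelian_subgroup[of "insert x M"] x Mc by blast
    then show "x \<in> M" using M unfolding maximal_abelian_subgroup_def by blast
  qed
qed (rule is_group)

lemma csa_at_conj:
  assumes csa: "csa_at G (carrier G) a" and a: "a \<in> carrier G" and g: "g \<in> carrier G"
  shows "csa_at G (carrier G) (g \<otimes> (a \<otimes> inv g))"
proof -
  define \<kappa> where "\<kappa> x = inv g \<otimes> (x \<otimes> g)" for x
  have \<kappa>_closed [simp]: "\<kappa> x \<in> carrier G" if "x \<in> carrier G" for x using that g by (simp add: \<kappa>_def)
  have \<kappa>_mult: "\<kappa> (x \<otimes> y) = \<kappa> x \<otimes> \<kappa> y" if "x \<in> carrier G" "y \<in> carrier G" for x y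
    using that g by (simp add: \<kappa>_def m_assoc)
  have \<kappa>_inv: "\<kappa> (inv x) = inv (\<kappa> x)" if "x \<in> carrier G" for x
    using that g by (simp add: \<kappa>_def m_assoc inv_mult_group)
  have \<kappa>_inj: "\<kappa> x = \<kappa> y \<longleftrightarrow> x = y" if "x \<in> carrier G" "y \<in> carrier G" for x y
    using that g by (simp add: \<kappa>_def)
  have \<kappa>_commute: "commute G (\<kappa> x) (\<kappa> y) \<longleftrightarrow> commute G x y" if "x \<in> carrier G" "y \<in> carrier G" for x y
    using that by (simp add: commute_def \<kappa>_inj flip: \<kappa>_mult)
  have \<kappa>_a: "\<kappa> (g \<otimes> (a \<otimes> inv g)) = a" using a g by (simp add: \<kappa>_def m_assoc)
  let ?b = "g \<otimes> (a \<otimes> inv g)"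
  have b: "?b \<in> carrier G" using a g by simp
  have "commute G x y" if "x \<in> carrier G" "y \<in> carrier G" "commute G ?b x" "commute G ?b y" for x y
    using csa that \<kappa>_commute[of ?b x] \<kappa>_commute[of ?b y] \<kappa>_commute[of x y] b
    by (auto simp: csa_at_def \<kappa>_a)
  moreover have "commute G ?b h" if h: "h \<in> carrier G" "commute G ?b (h \<otimes> (?b \<otimes> inv h))" for h
  proof -
    have "\<kappa> (h \<otimes> (?b \<otimes> inv h)) = \<kappa> h \<otimes> (a \<otimes> inv (\<kappa> h))"
      using h(1) b by (simp add: \<kappa>_mult \<kappa>_inv \<kappa>_a)
    then have "commute G a (\<kappa> h)"
      using csa h \<kappa>_commute[of ?b "h \<otimes> (?b \<otimes> inv h)"] b by (auto simp: csa_at_def \<kappa>_a)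
    then show ?thesis using \<kappa>_commute[of ?b h] h b by (simp add: \<kappa>_a)
  qed
  ultimately show ?thesis unfolding csa_at_def by blast
qed

lemma ord_eq_2_iff:
  assumes "x \<in> carrier G"
  shows "ord x = 2 \<longleftrightarrow> x \<otimes> x = \<one> \<and> x \<noteq> \<one>"
proof -
  have "x \<otimes> x = x [^] (2::nat)" using assms by (simp add: numeral_2_eq_2)
  then have "x \<otimes> x = \<one> \<longleftrightarrow> ord x dvd 2" using pow_eq_id[OF assms, of 2] by simp
  moreover have "ord x dvd 2 \<longleftrightarrow> ord x = 1 \<or> ord x = 2"
    using dvd_imp_le[of "ord x" 2] by (cases "ord x = 0") (auto simp: le_Suc_eq numeral_2_eq_2)
  moreover have "ord x = 1 \<longleftrightarrow> x = \<one>" using ord_eq_1[OF assms] .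
  ultimately show ?thesis by auto
qed

lemma malnormal_mal_closure:
  assumes "A \<subseteq> carrier G"
  shows "malnormal (mal_closure G A) G"
proof (rule malnormalI)
  have "malnormal (carrier G) G" by (rule malnormalI) (use subgroup_self in auto)
  then have ne: "{K. malnormal K G \<and> A \<subseteq> K} \<noteq> {}" using assms by blast
  show "subgroup (mal_closure G A) G"
    unfolding mal_closure_def
    by (rule subgroups_Inter) (use ne in \<open>auto simp: malnormal_def\<close>)
  show "x \<in> mal_closure G A"
    if "x \<in> carrier G" "k \<in> mal_closure G A" "inv x \<otimes> (k \<otimes> x) \<in> mal_closure G A" "k \<noteq> \<one>" for x k
    using that malnormalD unfolding mal_closure_def by blast
qed

end

section \<open>Reduced words\<close>

text \<open>The two factors are indexed by truth values, so that alternation between them is negation and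
  the factor of the \<open>k\<close>-th letter of a reduced word is determined by the parity of \<open>k\<close>.\<close>

locale two_factors = group P for P (structure) +
  fixes F :: "bool \<Rightarrow> 'a set"
  assumes factor_subgroup: "subgroup (F i) P"
begin

definition C :: "'a set" where "C = F True \<inter> F False"

definition wprod :: "'a list \<Rightarrow> 'a" where "wprod ws = foldr (\<otimes>) ws \<one>"

primrec reduced :: "bool \<Rightarrow> 'a list \<Rightarrow> bool" where
  "reduced i [] \<longleftrightarrow> True"
| "reduced i (x # xs) \<longleftrightarrow> x \<in> F i - C \<and> reduced (\<not> i) xs"

lemma factor_closed [simp]:
  "x \<in> F i \<Longrightarrow> x \<in> carrier P" "x \<in> F i \<Longrightarrow> y \<in> F i \<Longrightarrow> x \<otimes> y \<in> F i"
  "x \<in> F i \<Longrightarrow> inv x \<in> F i" "\<one> \<in> F i"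
  using factor_subgroup[of i] by (auto simp: subgroup_def)

lemma C_iff: "x \<in> C \<longleftrightarrow> (\<forall>i. x \<in> F i)"
  unfolding C_def by (auto simp: all_bool_eq)

lemma in_both_factors: "x \<in> F i \<Longrightarrow> x \<in> F (\<not> i) \<Longrightarrow> x \<in> C"
  by (cases i) (auto simp: C_def)

lemma C_in_factor [simp]: "x \<in> C \<Longrightarrow> x \<in> F i"
  by (simp add: C_iff)

lemma C_subgroup: "subgroup C P"
  unfolding C_def by (rule subgroups_Inter_pair[OF factor_subgroup factor_subgroup])

lemmas C_closed [simp] = subgroup.mem_carrier[OF C_subgroup] subgroup.m_closed[OF C_subgroup]
  subgroup.m_inv_closed[OF C_subgroup] subgroup.one_closed[OF C_subgroup]

lemma C_mult_cancel [simp]: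
  "c \<in> C \<Longrightarrow> x \<in> carrier P \<Longrightarrow> c \<otimes> x \<in> C \<longleftrightarrow> x \<in> C"
  "c \<in> C \<Longrightarrow> x \<in> carrier P \<Longrightarrow> x \<otimes> c \<in> C \<longleftrightarrow> x \<in> C"
proof -
  show "c \<otimes> x \<in> C \<longleftrightarrow> x \<in> C" if "c \<in> C" "x \<in> carrier P"
    using C_closed(2)[of "inv c" "c \<otimes> x"] that by auto
  show "x \<otimes> c \<in> C \<longleftrightarrow> x \<in> C" if "c \<in> C" "x \<in> carrier P"
    using C_closed(2)[of "x \<otimes> c" "inv c"] that by (auto simp: m_assoc)
qed

lemma inv_in_C_iff: "x \<in> carrier P \<Longrightarrow> inv x \<in> C \<longleftrightarrow> x \<in> C"
  using C_closed(3)[of "inv x"] by auto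

lemma wprod_simps [simp]: "wprod [] = \<one>" "wprod (x # xs) = x \<otimes> wprod xs"
  by (simp_all add: wprod_def)

lemma wprod_closed [simp]: "set ws \<subseteq> carrier P \<Longrightarrow> wprod ws \<in> carrier P"
  by (induction ws) auto

lemma wprod_append:
  "set us \<subseteq> carrier P \<Longrightarrow> set vs \<subseteq> carrier P \<Longrightarrow> wprod (us @ vs) = wprod us \<otimes> wprod vs"
  by (induction us) (auto simp: m_assoc)

lemma wprod_rev_inv: "set us \<subseteq> carrier P \<Longrightarrow> wprod (rev (map (m_inv P) us)) = inv (wprod us)"
proof (induction us)
  case (Cons x us)
  then have "set (rev (map (m_inv P) us)) \<subseteq> carrier P" by auto
  then show ?case using Cons by (simp add: wprod_append inv_mult_group)
qed simp

lemma reduced_in_carrier: "reduced i us \<Longrightarrow> set us \<subseteq> carrier P"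
  by (induction us arbitrary: i) auto

lemma reduced_wprod_closed [simp]: "reduced i us \<Longrightarrow> wprod us \<in> carrier P"
  using reduced_in_carrier wprod_closed by blast

lemma reduced_append:
  "reduced i (us @ vs) \<longleftrightarrow> reduced i us \<and> reduced (i = even (length us)) vs"
proof (induction us arbitrary: i)
  case (Cons x us)
  have "((\<not> i) = even (length us)) = (i = even (length (x # us)))" by auto
  then show ?case using Cons by simp
qed simp

lemma reduced_iff_nth: "reduced i ws \<longleftrightarrow> (\<forall>k<length ws. ws ! k \<in> F (i = even k) - C)"
proof (induction ws arbitrary: i)
  case (Cons x ws)
  have "((\<not> i) = even k) = (i = even (Suc k))" for k by auto
  then have "reduced (\<not> i) ws \<longleftrightarrow> (\<forall>k<length ws. (x # ws) ! Suc k \<in> F (i = even (Suc k)) - C)"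
    using Cons by simp
  then show ?case by (simp add: All_less_Suc2)
qed simp

lemma reduced_rev_inv:
  "reduced i us \<Longrightarrow> reduced (i = odd (length us)) (rev (map (m_inv P) us))"
proof (induction us arbitrary: i)
  case (Cons x us)
  have x: "x \<in> F i" "x \<notin> C" and us: "reduced (\<not> i) us" using Cons.prems by auto
  have "reduced (i = odd (length (x # us))) (rev (map (m_inv P) us))"
  proof -
    have "((\<not> i) = odd (length us)) = (i = odd (length (x # us)))" by auto
    then show ?thesis using Cons.IH[OF us] by simp
  qed
  moreover have "((i = odd (length (x # us))) = even (length us)) = i" by auto
  ultimately show ?case using x by (simp add: reduced_append inv_in_C_iff[of x])
qed simp

end

text \<open>An internal description of the amalgamated product: a group generated by two subgroups in
  which no nonempty reduced word represents an element of their intersection.\<close>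

locale amalgam = two_factors +
  assumes reduced_wprod_notin_C: "reduced i ws \<Longrightarrow> ws \<noteq> [] \<Longrightarrow> wprod ws \<notin> C"
    and factors_generate: "x \<in> carrier P \<Longrightarrow> \<exists>ws. set ws \<subseteq> F True \<union> F False \<and> x = wprod ws"
begin

text \<open>At the first place where the words differ by more than an element of \<open>C\<close>, the inverse of one
  followed by the other would be a nonempty reduced word of an element of \<open>C\<close>. The element \<open>c\<close> is
  what is left over from the letters that have already been cancelled; it makes the induction
  work. The conclusion about \<open>take k\<close> says that both words describe the same path in the
  Bass-Serre tree, whose edges are the left cosets of \<open>C\<close>.\<close>

lemma reduced_unique:
  assumes "reduced i us" "reduced j vs" "c \<in> C" "inv (wprod us) \<otimes> (c \<otimes> wprod vs) \<in> C"
  shows "length us = length vs \<and> (us \<noteq> [] \<longrightarrow> i = j) \<and>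
    (\<forall>k. inv (wprod (take k us)) \<otimes> (c \<otimes> wprod (take k vs)) \<in> C)"
  using assms
proof (induction us arbitrary: i j vs c)
  case Nil
  then have "wprod vs \<in> C" by simp
  then have "vs = []" using reduced_wprod_notin_C Nil by blast
  then show ?case using Nil by simp
next
  case (Cons x us)
  have x: "x \<in> F i" "x \<notin> C" and us: "reduced (\<not> i) us" using Cons.prems by auto
  have c: "c \<in> C" by (rule Cons.prems)
  define ur where "ur = rev (map (m_inv P) us)"
  have ur: "reduced (i = even (length us)) ur" "wprod ur = inv (wprod us)" "length ur = length us"
    using reduced_rev_inv[OF us] wprod_rev_inv[OF reduced_in_carrier[OF us]]
    by (simp_all add: ur_def)
  show ?case
  proof (cases vs)
    case Nil
    then have "inv (wprod (x # us)) \<in> C" using Cons.prems x us by simp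
    then have "wprod (x # us) \<in> C" using Cons.prems inv_in_C_iff reduced_wprod_closed by blast
    then show ?thesis using reduced_wprod_notin_C Cons.prems by blast
  next
    case (Cons y vs')
    have y: "y \<in> F j" "y \<notin> C" and vs': "reduced (\<not> j) vs'" using Cons Cons.prems by auto
    have "i = j"
    proof (rule ccontr)
      assume "i \<noteq> j"
      then have red: "reduced (i = even (length us)) (ur @ [inv x, c \<otimes> y] @ vs')"
        using ur x y c vs' by (auto simp: reduced_append inv_in_C_iff)
      have "wprod (ur @ [inv x, c \<otimes> y] @ vs') = inv (wprod us) \<otimes> (inv x \<otimes> ((c \<otimes> y) \<otimes> wprod vs'))"
        using reduced_in_carrier[OF ur(1)] reduced_in_carrier[OF vs'] x y c
        by (simp add: wprod_append ur m_assoc)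
      also have "\<dots> = inv (wprod (x # us)) \<otimes> (c \<otimes> wprod vs)"
        using x y c us vs' Cons by (simp add: m_assoc inv_mult_group)
      finally show False using reduced_wprod_notin_C[OF red] Cons.prems by simp
    qed
    define z where "z = inv x \<otimes> (c \<otimes> y)"
    have z: "z \<in> F i" using x y c \<open>i = j\<close> by (simp add: z_def)
    have step: "inv (x \<otimes> u) \<otimes> (c \<otimes> (y \<otimes> v)) = inv u \<otimes> (z \<otimes> v)"
      if "u \<in> carrier P" "v \<in> carrier P" for u v
      using that x y c by (simp add: z_def m_assoc inv_mult_group)
    have "z \<in> C"
    proof (rule ccontr)
      assume "z \<notin> C"
      then have red: "reduced (i = even (length us)) (ur @ [z] @ vs')"
        using ur z vs' \<open>i = j\<close> by (auto simp: reduced_append)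
      have "wprod (ur @ [z] @ vs') = inv (wprod us) \<otimes> (z \<otimes> wprod vs')"
        using reduced_in_carrier[OF ur(1)] reduced_in_carrier[OF vs'] z
        by (simp add: wprod_append ur)
      then show False
        using reduced_wprod_notin_C[OF red] Cons.prems step us vs' Cons by simp
    qed
    moreover have "inv (wprod us) \<otimes> (z \<otimes> wprod vs') \<in> C"
      using Cons.prems Cons step us vs' by simp
    ultimately have IH: "length us = length vs'"
      "inv (wprod (take k us)) \<otimes> (z \<otimes> wprod (take k vs')) \<in> C" for k
      using Cons.IH[OF us vs'] by auto
    have "inv (wprod (take k (x # us))) \<otimes> (c \<otimes> wprod (take k vs)) \<in> C" for k
    proof (cases k)
      case (Suc k')
      have "set (take k' us) \<subseteq> carrier P" "set (take k' vs') \<subseteq> carrier P"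
        using us vs' by (auto dest!: reduced_in_carrier in_set_takeD)
      then show ?thesis using IH(2)[of k'] Suc Cons step by simp
    qed (use c in simp)
    then show ?thesis using IH(1) \<open>i = j\<close> Cons by simp
  qed
qed

lemma reduced_unique_eq:
  assumes "reduced i us" "reduced j vs" "wprod us = wprod vs"
  shows "length us = length vs" "us \<noteq> [] \<Longrightarrow> i = j"
    "inv (wprod (take k us)) \<otimes> wprod (take k vs) \<in> C"
proof -
  have "inv (wprod us) \<otimes> (\<one> \<otimes> wprod vs) \<in> C" using assms by simp
  from reduced_unique[OF assms(1,2) C_closed(4) this]
  have "length us = length vs" "us \<noteq> [] \<longrightarrow> i = j"
    "inv (wprod (take k us)) \<otimes> (\<one> \<otimes> wprod (take k vs)) \<in> C" by blast+
  moreover have "set (take k vs) \<subseteq> carrier P"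
    using assms(2) by (auto dest!: reduced_in_carrier in_set_takeD)
  ultimately show "length us = length vs" "us \<noteq> [] \<Longrightarrow> i = j"
    "inv (wprod (take k us)) \<otimes> wprod (take k vs) \<in> C" by simp_all
qed

lemma long_reduced_wprod_notin_factor:
  assumes "reduced i ws" "2 \<le> length ws"
  shows "wprod ws \<notin> F j"
proof
  assume w: "wprod ws \<in> F j"
  have "ws \<noteq> []" using assms(2) by auto
  then have "wprod ws \<notin> C" by (rule reduced_wprod_notin_C[OF assms(1)])
  then have "reduced j [wprod ws]" using w by simp
  moreover have "wprod ws = wprod [wprod ws]" using assms(1) by simp
  ultimately have "length ws = length [wprod ws]" by (rule reduced_unique_eq(1)[OF assms(1)])
  then show False using assms(2) by simp
qed

text \<open>The two ways in which a reduced word meets a further element of a factor on its right. If the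
  word is empty, its starting index can be chosen to suit that element, hence the new index \<open>j\<close>.\<close>

lemma reduced_snoc_cases:
  assumes "reduced i us" "z \<in> F f"
  obtains (extend) j where "us = [] \<or> j = i" "reduced j us" "f = (j = even (length us))"
  | (merge) us' y where "us = us' @ [y]" "reduced i us'" "f = (i = even (length us'))" "y \<in> F f - C"
proof (cases "us = [] \<or> f = (i = even (length us))")
  case True
  show ?thesis
  proof (cases "us = []")
    case True
    then show ?thesis using extend[of f] by simp
  next
    case False
    then show ?thesis using extend[of i] assms(1) True by simp
  qed
next
  case False
  then obtain us' y where us': "us = us' @ [y]" by (metis rev_exhaust)
  then have "f = (i = even (length us'))" using False by auto
  then show ?thesis using merge[of us' y] us' assms(1) by (simp add: reduced_append)
qed

lemma exists_reduced_form:
  assumes "x \<in> carrier P"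
  shows "\<exists>i us c. reduced i us \<and> c \<in> C \<and> x = wprod us \<otimes> c"
proof -
  have "\<exists>i us c. reduced i us \<and> c \<in> C \<and> wprod ws = wprod us \<otimes> c"
    if "set ws \<subseteq> F True \<union> F False" for ws
    using that
  proof (induction ws rule: rev_induct)
    case Nil
    have "reduced True []" "\<one> \<in> C" "wprod [] = wprod [] \<otimes> \<one>" by simp_all
    then show ?case by blast
  next
    case (snoc z ws)
    then obtain i us c where us: "reduced i us" and c: "c \<in> C" and w: "wprod ws = wprod us \<otimes> c"
      by auto
    obtain f where "z \<in> F f" using snoc.prems by auto
    then have cz: "c \<otimes> z \<in> F f" using c by simp
    have "set ws \<subseteq> carrier P" "z \<in> carrier P" using snoc.prems by auto
    then have eq: "wprod (ws @ [z]) = wprod us \<otimes> (c \<otimes> z)"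
      using w us c by (simp add: wprod_append m_assoc)
    show ?case
    proof (cases "c \<otimes> z \<in> C")
      case True
      then show ?thesis using us eq by blast
    next
      case False
      show ?thesis using us cz
      proof (cases rule: reduced_snoc_cases)
        case (extend j)
        have "reduced j (us @ [c \<otimes> z])" using extend cz False by (simp add: reduced_append)
        moreover from this have "wprod (ws @ [z]) = wprod (us @ [c \<otimes> z]) \<otimes> \<one>"
          using eq reduced_in_carrier[OF us] factor_closed(1)[OF cz] by (simp add: wprod_append)
        ultimately show ?thesis using C_closed(4) by blast
      next
        case (merge us' y)
        have carr: "set us' \<subseteq> carrier P" "y \<in> carrier P" "c \<otimes> z \<in> carrier P"
          using reduced_in_carrier[OF merge(2)] factor_closed(1)[OF cz] factor_closed(1)[of y f] merge(4)
          by auto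
        then have eq': "wprod (ws @ [z]) = wprod us' \<otimes> (y \<otimes> (c \<otimes> z))"
          using eq merge(1) by (simp add: wprod_append m_assoc)
        show ?thesis
        proof (cases "y \<otimes> (c \<otimes> z) \<in> C")
          case True
          then show ?thesis using eq' merge by blast
        next
          case False
          then have red: "reduced i (us' @ [y \<otimes> (c \<otimes> z)])"
            using merge cz by (simp add: reduced_append)
          have "wprod (ws @ [z]) = wprod (us' @ [y \<otimes> (c \<otimes> z)]) \<otimes> \<one>"
            using eq' carr by (simp add: wprod_append)
          then show ?thesis using red C_closed(4) by blast
        qed
      qed
    qed
  qed
  then show ?thesis using factors_generate[OF assms] by blast
qed

text \<open>The reduced path in the Bass-Serre tree from the vertex \<open>F f\<close> to its translate by \<open>x\<close>: the
  parity condition keeps \<open>us\<close> from ending in \<open>F f\<close>, so that factor is absorbed into \<open>h\<close>.\<close>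

lemma exists_form_with_tail:
  assumes "x \<in> carrier P"
  shows "\<exists>i us h. reduced i us \<and> h \<in> F f \<and> x = wprod us \<otimes> h \<and> f = (i = even (length us))"
proof -
  obtain i us c where us: "reduced i us" and c: "c \<in> C" and x: "x = wprod us \<otimes> c"
    using exists_reduced_form[OF assms] by blast
  from us C_in_factor[OF c, of f] show ?thesis
  proof (cases rule: reduced_snoc_cases)
    case (extend j)
    then show ?thesis using c x by (metis C_in_factor)
  next
    case (merge us' y)
    then have "x = wprod us' \<otimes> (y \<otimes> c)" "y \<otimes> c \<in> F f"
      using c x reduced_in_carrier[OF merge(2)] factor_closed(1)[of y f]
      by (simp_all add: wprod_append m_assoc)
    then show ?thesis using merge by blast
  qed
qed

text \<open>Writing \<open>x\<close> as a word ending in \<open>h \<in> F f\<close>, a conjugate of \<open>a\<close> by \<open>h\<close> that is outside \<open>C\<close> would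
  sit in the middle of a reduced word for the conjugate by \<open>x\<close>, which is too long to be in a factor.\<close>

lemma conjugate_into_same_factor:
  assumes a: "a \<in> F f" and x: "x \<in> carrier P" "x \<notin> F f" and xa: "x \<otimes> (a \<otimes> inv x) \<in> F f"
  obtains i us y h where "reduced i (us @ [y])" "y \<in> F (\<not> f)" "h \<in> F f"
    "h \<otimes> (a \<otimes> inv h) \<in> C" "x = wprod (us @ [y]) \<otimes> h"
proof -
  obtain i us h where us: "reduced i us" "h \<in> F f" "x = wprod us \<otimes> h" "f = (i = even (length us))"
    using exists_form_with_tail[OF x(1), of f] by blast
  have "us \<noteq> []" using us x by auto
  then obtain us' y where us': "us = us' @ [y]" by (metis rev_exhaust)
  have y: "y \<in> F (\<not> f)" using us us' by (auto simp: reduced_append)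
  define b where "b = h \<otimes> (a \<otimes> inv h)"
  have b: "b \<in> F f" using us a by (simp add: b_def)
  have conj: "x \<otimes> (a \<otimes> inv x) = wprod us \<otimes> (b \<otimes> inv (wprod us))"
    using us a by (simp add: b_def m_assoc inv_mult_group)
  have "b \<in> C"
  proof (rule ccontr)
    assume "b \<notin> C"
    then have red: "reduced i (us @ [b] @ rev (map (m_inv P) us))"
      using us b reduced_rev_inv[OF us(1)] by (auto simp: reduced_append)
    have "wprod (us @ [b] @ rev (map (m_inv P) us)) = x \<otimes> (a \<otimes> inv x)"
      using us b conj reduced_in_carrier[OF us(1)] reduced_in_carrier[OF red]
      by (simp add: wprod_append wprod_rev_inv)
    then show False
      using long_reduced_wprod_notin_factor[OF red, of f] xa us' by simp
  qed
  then show thesis using that us us' y unfolding b_def by metis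
qed

text \<open>As long as a word has odd length at least 3, its first and last letter lie in the same factor;
  conjugation moves the first letter to the end, where it merges with the last one.\<close>

lemma cyclic_reduction:
  assumes "x \<in> carrier P"
  shows "\<exists>g\<in>carrier P. \<exists>y. x = g \<otimes> (y \<otimes> inv g) \<and>
    ((\<exists>f. y \<in> F f) \<or> (\<exists>i ws. reduced i ws \<and> ws \<noteq> [] \<and> even (length ws) \<and> y = wprod ws))"
proof -
  define Q where "Q x \<longleftrightarrow> (\<exists>g\<in>carrier P. \<exists>y. x = g \<otimes> (y \<otimes> inv g) \<and>
    ((\<exists>f. y \<in> F f) \<or> (\<exists>i ws. reduced i ws \<and> ws \<noteq> [] \<and> even (length ws) \<and> y = wprod ws)))" for x
  have Q_conj: "Q (g \<otimes> (x \<otimes> inv g))" if g: "g \<in> carrier P" and "Q x" for g x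
  proof -
    obtain h y where h: "h \<in> carrier P" "x = h \<otimes> (y \<otimes> inv h)"
      and y: "(\<exists>f. y \<in> F f) \<or> (\<exists>i ws. reduced i ws \<and> ws \<noteq> [] \<and> even (length ws) \<and> y = wprod ws)"
      using \<open>Q x\<close> unfolding Q_def by blast
    have "y \<in> carrier P" using y by auto
    then have "g \<otimes> (x \<otimes> inv g) = (g \<otimes> h) \<otimes> (y \<otimes> inv (g \<otimes> h))"
      using g h by (simp add: m_assoc inv_mult_group)
    then show ?thesis using g h y unfolding Q_def by (metis m_closed)
  qed
  have Q_factor: "Q y" if "y \<in> F f" for y f
    unfolding Q_def
    by (intro bexI[of _ \<one>] exI[of _ y] conjI disjI1 exI[of _ f])
      (use that factor_closed(1)[OF that] in simp_all)
  have "Q (wprod ws \<otimes> c)" if "reduced i ws" "c \<in> C" for i ws c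
    using that
  proof (induction "length ws" arbitrary: i ws c rule: less_induct)
    case less
    have ws: "reduced i ws" and c: "c \<in> C" by fact+
    consider "ws = []" | "ws \<noteq> []" "even (length ws)" | y where "ws = [y]"
      | x vs y where "ws = x # vs @ [y]" "odd (length vs)"
    proof (cases ws)
      case (Cons x vs)
      show ?thesis
      proof (cases vs rule: rev_cases)
        case Nil
        then show ?thesis using that(3) Cons by simp
      next
        case (snoc ys y)
        then show ?thesis using that(2) that(4)[of x ys y] Cons by (cases "even (length ys)") auto
      qed
    qed (use that in blast)
    then show ?case
    proof cases
      case 1
      then show ?thesis using Q_factor[of c True] c by simp
    next
      case 2
      define vs where "vs = butlast ws @ [last ws \<otimes> c]"
      have wsl: "ws = butlast ws @ [last ws]" using 2 by simp
      then have l: "reduced i (butlast ws @ [last ws])" using ws by simp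
      then have vs: "reduced i vs" using c by (auto simp: vs_def reduced_append)
      have "wprod vs = wprod (butlast ws @ [last ws]) \<otimes> c"
        using l c by (auto simp: vs_def reduced_append wprod_append reduced_in_carrier m_assoc)
      then have "wprod ws \<otimes> c = wprod vs" using wsl by simp
      moreover have "length vs = length ws" using 2 by (simp add: vs_def)
      moreover from this 2 have "vs \<noteq> []" by auto
      ultimately show ?thesis unfolding Q_def
        by (intro bexI[of _ \<one>] exI[of _ "wprod vs"] conjI disjI2 exI[of _ i] exI[of _ vs])
          (use vs 2 reduced_wprod_closed[OF vs] in simp_all)
    next
      case 3
      then show ?thesis using Q_factor[of "y \<otimes> c" i] ws c factor_closed(1)[of y i] by simp
    next
      case 4
      have x: "x \<in> F i - C" and vs: "reduced (\<not> i) vs" and y: "y \<in> F i - C"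
        using ws 4 by (simp_all add: reduced_append)
      have carr: "x \<in> carrier P" "y \<in> carrier P" "set vs \<subseteq> carrier P"
        using x y factor_closed(1)[of x i] factor_closed(1)[of y i] reduced_in_carrier[OF vs] by simp_all
      define z where "z = y \<otimes> (c \<otimes> x)"
      have z: "z \<in> F i" using x y c by (simp add: z_def)
      have "wprod ws \<otimes> c = x \<otimes> ((wprod vs \<otimes> z) \<otimes> inv x)"
        using 4 carr c by (simp add: z_def wprod_append m_assoc)
      moreover have "Q (wprod vs \<otimes> z)"
      proof (cases "z \<in> C")
        case True
        then show ?thesis using less.hyps[of vs] vs 4 by simp
      next
        case False
        then have "reduced (\<not> i) (vs @ [z])" using vs z 4 by (simp add: reduced_append)
        then have "Q (wprod (vs @ [z]) \<otimes> \<one>)" using less.hyps[of "vs @ [z]" "\<not> i" "\<one>"] 4 by simp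
        then show ?thesis using carr factor_closed(1)[OF z] by (simp add: wprod_append)
      qed
      ultimately show ?thesis using Q_conj[of x] carr by simp
    qed
  qed
  then have "Q x" using exists_reduced_form[OF assms] by blast
  then show ?thesis unfolding Q_def .
qed

end

section \<open>Elements conjugate into a factor\<close>

locale malnormal_amalgam = amalgam +
  assumes C_malnormal: "c \<in> C \<Longrightarrow> g \<in> F True - C \<Longrightarrow> inv g \<otimes> (c \<otimes> g) \<in> C \<Longrightarrow> c = \<one>"
begin

text \<open>An element \<open>a\<close> of the second factor fixes the vertex \<open>F False\<close> of the Bass-Serre tree. If it
  also fixes another such vertex, it fixes two edges at a vertex of the first kind, whose
  stabilisers intersect trivially because \<open>C\<close> is malnormal in \<open>F True\<close>.\<close>

lemma F_False_malnormal:
  assumes a: "a \<in> F False" "a \<noteq> \<one>" and x: "x \<in> carrier P" "x \<otimes> (a \<otimes> inv x) \<in> F False"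
  shows "x \<in> F False"
proof (rule ccontr)
  assume "x \<notin> F False"
  then obtain i us y h where us: "reduced i (us @ [y])" and y: "y \<in> F True" and h: "h \<in> F False"
    and b: "h \<otimes> (a \<otimes> inv h) \<in> C" and x_eq: "x = wprod (us @ [y]) \<otimes> h"
    using conjugate_into_same_factor[OF a(1) x(1) _ x(2)] by (metis (full_types))
  define b where "b = h \<otimes> (a \<otimes> inv h)"
  define z where "z = y \<otimes> (b \<otimes> inv y)"
  have carr: "a \<in> carrier P" "y \<in> carrier P" "h \<in> carrier P" "b \<in> carrier P"
    and us': "set us \<subseteq> carrier P"
    using factor_closed(1)[OF a(1)] factor_closed(1)[OF y] factor_closed(1)[OF h]
      reduced_in_carrier[OF us] by (auto simp: b_def)
  have "b \<noteq> \<one>" using conj_eq_one_iff[of h a] carr a by (simp add: b_def)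
  have bC: "b \<in> C" using b by (simp add: b_def)
  have yC: "y \<notin> C" and red: "reduced i us" and "y \<in> F (i = even (length us))"
    using us by (simp_all add: reduced_append)
  then have i: "i = even (length us)"
    using in_both_factors[OF y] y by (cases "i = even (length us)") auto
  have "z \<in> F True" using y bC by (simp add: z_def)
  moreover have "z \<notin> C"
    using C_malnormal[of b "inv y"] \<open>b \<noteq> \<one>\<close> bC y yC carr inv_in_C_iff[of y] by (auto simp: z_def)
  ultimately have red': "reduced i (us @ [z] @ rev (map (m_inv P) us))"
    using red reduced_rev_inv[OF red] i by (simp add: reduced_append)
  have inv_us: "set (rev (map (m_inv P) us)) \<subseteq> carrier P" using us' by auto
  have "x \<otimes> (a \<otimes> inv x) = wprod us \<otimes> (z \<otimes> inv (wprod us))"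
    using carr us' by (simp add: x_eq wprod_append z_def b_def m_assoc inv_mult_group)
  also have "\<dots> = wprod (us @ [z] @ rev (map (m_inv P) us))"
    using carr us' inv_us by (simp add: wprod_append wprod_rev_inv z_def)
  finally have *: "wprod (us @ [z] @ rev (map (m_inv P) us)) \<in> F False" using x by simp
  show False
  proof (cases "us = []")
    case True
    then have "z \<in> F False" using * carr by (simp add: z_def)
    then show False using \<open>z \<in> F True\<close> \<open>z \<notin> C\<close> in_both_factors[of z True] by simp
  next
    case False
    then have "2 \<le> length (us @ [z] @ rev (map (m_inv P) us))" by (cases us) auto
    then show False using long_reduced_wprod_notin_factor[OF red'] * by blast
  qed
qed

lemma F_True_malnormal_outside_conjugates_of_C:
  assumes a: "a \<in> F True" and x: "x \<in> carrier P" "x \<otimes> (a \<otimes> inv x) \<in> F True"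
    and not_conj: "\<And>h. h \<in> carrier P \<Longrightarrow> h \<otimes> (a \<otimes> inv h) \<notin> C"
  shows "x \<in> F True"
proof (rule ccontr)
  assume "x \<notin> F True"
  from conjugate_into_same_factor[OF a x(1) this x(2)] obtain h
    where "h \<in> F True" "h \<otimes> (a \<otimes> inv h) \<in> C" by blast
  then show False using not_conj[of h] factor_closed(1)[of h True] by blast
qed

lemma csa_at_lift:
  assumes csa: "csa_at P (F f) a" and a: "a \<in> F f"
    and control: "\<And>x. x \<in> carrier P \<Longrightarrow> x \<otimes> (a \<otimes> inv x) \<in> F f \<Longrightarrow> x \<in> F f"
  shows "csa_at P (carrier P) a"
proof -
  have ac: "a \<in> carrier P" using factor_closed(1)[OF a] .
  have centraliser: "x \<in> F f" if "x \<in> carrier P" "commute P a x" for x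
    using control[of x] commute_iff_conj[of x a] that ac a by simp
  then have "commute P x y" if "x \<in> carrier P" "y \<in> carrier P" "commute P a x" "commute P a y" for x y
    using csa that unfolding csa_at_def by blast
  moreover have "commute P a g"
    if g: "g \<in> carrier P" "commute P a (g \<otimes> (a \<otimes> inv g))" for g
  proof -
    have "g \<in> F f" using control[of g] centraliser[of "g \<otimes> (a \<otimes> inv g)"] g ac by simp
    then show ?thesis using csa g unfolding csa_at_def by blast
  qed
  ultimately show ?thesis unfolding csa_at_def by blast
qed

text \<open>An element that is conjugate into \<open>C\<close> is handled in the second factor, which is malnormal; an
  element of the first factor that is not is controlled by the first factor alone.\<close>

lemma csa_at_in_factor:
  assumes csa: "\<And>f a. a \<in> F f \<Longrightarrow> a \<noteq> \<one> \<Longrightarrow> csa_at P (F f) a"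
    and a: "a \<in> F f" "a \<noteq> \<one>"
  shows "csa_at P (carrier P) a"
proof -
  have F_False: "csa_at P (carrier P) b" if "b \<in> F False" "b \<noteq> \<one>" for b
    using csa_at_lift[OF csa] F_False_malnormal that by blast
  show ?thesis
  proof (cases f)
    case False
    then show ?thesis using F_False a by simp
  next
    case True
    then have aT: "a \<in> F True" using a by simp
    have ac: "a \<in> carrier P" using factor_closed(1)[OF aT] .
    show ?thesis
    proof (cases "\<exists>h\<in>carrier P. h \<otimes> (a \<otimes> inv h) \<in> C")
      case True
      then obtain h where h: "h \<in> carrier P" "h \<otimes> (a \<otimes> inv h) \<in> C" by blast
      have "csa_at P (carrier P) (h \<otimes> (a \<otimes> inv h))"
        by (rule F_False[OF C_in_factor[OF h(2)]]) (use conj_eq_one_iff[OF h(1) ac] a in simp)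
      from csa_at_conj[OF this, of "inv h"] show ?thesis using h ac by (simp add: m_assoc)
    next
      case False
      then show ?thesis
        using csa_at_lift[OF csa[OF aT a(2)] aT] F_True_malnormal_outside_conjugates_of_C[OF aT] by blast
    qed
  qed
qed

end


section \<open>Centralisers of cyclically reduced elements\<close>

text \<open>An automorphism of an infinite cyclic group is the identity or inversion. The cyclic group is
  given by an injective homomorphism \<open>\<beta>\<close> to the integers instead of a generator.\<close>

lemma (in group) conjugation_acts_by_sign:
  fixes \<beta> :: "'a \<Rightarrow> int"
  assumes Z: "subgroup Z G"
    and hom: "\<And>x y. x \<in> Z \<Longrightarrow> y \<in> Z \<Longrightarrow> \<beta> (x \<otimes> y) = \<beta> x + \<beta> y"
    and inj: "\<And>x. x \<in> Z \<Longrightarrow> \<beta> x = 0 \<Longrightarrow> x = \<one>"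
    and g: "g \<in> carrier G"
    and conj: "\<And>x. x \<in> Z \<Longrightarrow> g \<otimes> (x \<otimes> inv g) \<in> Z" "\<And>x. x \<in> Z \<Longrightarrow> inv g \<otimes> (x \<otimes> g) \<in> Z"
    and a: "a \<in> Z" "a \<noteq> \<one>"
  obtains k where "k = 1 \<or> k = -1" "\<And>x. x \<in> Z \<Longrightarrow> \<beta> (g \<otimes> (x \<otimes> inv g)) = k * \<beta> x"
proof -
  define \<beta>' where "\<beta>' x = \<beta> (g \<otimes> (x \<otimes> inv g))" for x
  note Zsimps = subgroup.m_closed[OF Z] subgroup.m_inv_closed[OF Z] subgroup.one_closed[OF Z]
    subgroup.mem_carrier[OF Z]
  have hom': "\<beta>' (x \<otimes> y) = \<beta>' x + \<beta>' y" if "x \<in> Z" "y \<in> Z" for x y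
    using hom[of "g \<otimes> (x \<otimes> inv g)" "g \<otimes> (y \<otimes> inv g)"] conj that g
    by (simp add: \<beta>'_def m_assoc Zsimps)
  have one: "\<beta> \<one> = 0" "\<beta>' \<one> = 0" using hom[of \<one> \<one>] hom'[of \<one> \<one>] Zsimps by simp_all
  have inv: "\<beta> (inv x) = - \<beta> x" "\<beta>' (inv x) = - \<beta>' x" if "x \<in> Z" for x
    using hom[of x "inv x"] hom'[of x "inv x"] that one by (simp_all add: Zsimps)
  \<comment> \<open>The image of \<open>\<beta>\<close> consists of the multiples of \<open>d\<close>, and \<open>e\<close> is a generator of \<open>Z\<close>.\<close>
  define d where "d = (LEAST n. 0 < n \<and> (\<exists>e\<in>Z. \<beta> e = int n))"
  have ex: "\<exists>n. 0 < n \<and> (\<exists>e\<in>Z. \<beta> e = int n)"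
  proof -
    have "\<beta> a \<noteq> 0" using inj a by blast
    then consider "\<beta> a = int (nat (\<beta> a))" "0 < nat (\<beta> a)"
      | "\<beta> (inv a) = int (nat (\<beta> (inv a)))" "0 < nat (\<beta> (inv a))"
      using inv(1)[OF a(1)] by linarith
    then show ?thesis using a Zsimps(2) by cases blast+
  qed
  then have "0 < d \<and> (\<exists>e\<in>Z. \<beta> e = int d)" unfolding d_def by (rule LeastI_ex)
  then obtain e where d: "0 < d" and e: "e \<in> Z" "\<beta> e = int d" by blast
  have min: "d \<le> n" if "0 < n" "x \<in> Z" "\<beta> x = int n" for n x
    unfolding d_def by (rule Least_le) (use that in blast)
  have pos: "\<beta>' x * int d = \<beta> x * \<beta>' e \<and> int d dvd \<beta> x" if "x \<in> Z" "\<beta> x = int n" for x n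
    using that
  proof (induction n arbitrary: x rule: less_induct)
    case (less n)
    show ?case
    proof (cases "n = 0")
      case True
      then have "x = \<one>" using inj less.prems by simp
      then show ?thesis using one by simp
    next
      case False
      then have "d \<le> n" using min less.prems by blast
      define y where "y = x \<otimes> inv e"
      have y: "y \<in> Z" "\<beta> y = \<beta> x - int d" "\<beta>' y = \<beta>' x - \<beta>' e"
        using less.prems e hom[of x "inv e"] hom'[of x "inv e"] inv[OF e(1)]
        by (simp_all add: y_def Zsimps)
      then have "\<beta> y = int (n - d)" using less.prems \<open>d \<le> n\<close> by simp
      then have "\<beta>' y * int d = \<beta> y * \<beta>' e \<and> int d dvd \<beta> y"
        using less.IH[of "n - d" y] y(1) d False by simp
      moreover have "\<beta> x = \<beta> y + int d" "\<beta>' x = \<beta>' y + \<beta>' e" using y by simp_all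
      ultimately show ?thesis by (simp add: algebra_simps)
    qed
  qed
  have all: "\<beta>' x * int d = \<beta> x * \<beta>' e \<and> int d dvd \<beta> x" if "x \<in> Z" for x
  proof (cases "0 \<le> \<beta> x")
    case True
    then show ?thesis using pos[OF that, of "nat (\<beta> x)"] by simp
  next
    case False
    then show ?thesis using pos[of "inv x" "nat (- \<beta> x)"] that inv[OF that] Zsimps(2)[OF that] by simp
  qed
  have "int d dvd \<beta>' e" using all[OF conj(1)[OF e(1)]] by (simp add: \<beta>'_def)
  then obtain k where k: "\<beta>' e = k * int d" by (metis dvdE mult.commute)
  have lin: "\<beta>' x = k * \<beta> x" if "x \<in> Z" for x
    using all[OF that] d k by simp
  \<comment> \<open>The factor \<open>k\<close> is a unit because the inverse automorphism also scales \<open>\<beta>\<close> by an integer.\<close>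
  define f where "f = inv g \<otimes> (e \<otimes> g)"
  have f: "f \<in> Z" "\<beta>' f = int d"
    using conj(2)[OF e(1)] e g by (simp_all add: f_def \<beta>'_def m_assoc Zsimps)
  obtain l where "\<beta> f = int d * l" using all[OF f(1)] by (auto elim: dvdE)
  then have "int d * (k * l) = int d * 1" using lin[OF f(1)] f(2) by (simp add: mult_ac)
  then have "k * l = 1" using d by simp
  then have "k = 1 \<or> k = -1" using zmult_eq_1_iff by blast
  then show thesis using that lin unfolding \<beta>'_def by blast
qed

text \<open>A cyclically reduced word \<open>ws\<close>, repeated forever, is a ray in the Bass-Serre tree: its
  edges are the cosets of \<open>C\<close> represented by \<open>prefix k\<close>, and it is one half of the axis of the
  element \<open>wprod ws\<close>. Evenness of the length makes the infinite repetition reduced.\<close>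

locale periodic_ray = malnormal_amalgam +
  fixes i :: bool and ws :: "'a list"
  assumes ws_reduced: "reduced i ws" and ws_nonempty: "ws \<noteq> []" and ws_even: "even (length ws)"
begin

definition letter :: "nat \<Rightarrow> 'a" where "letter k = ws ! (k mod length ws)"

definition prefix :: "nat \<Rightarrow> 'a" where "prefix k = wprod (map letter [0..<k])"

lemma letter_in: "letter k \<in> F (i = even k) - C"
proof -
  have "k mod length ws < length ws" using ws_nonempty by simp
  moreover have "even (k mod length ws) = even k" using ws_even by (simp add: dvd_mod_iff)
  ultimately show ?thesis
    using ws_reduced[unfolded reduced_iff_nth, rule_format, of "k mod length ws"]
    by (simp add: letter_def)
qed

lemma letter_closed [simp]: "letter k \<in> carrier P"
  using letter_in[of k] factor_closed(1) by blast

lemma letters_closed [simp]: "letter ` S \<subseteq> carrier P"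
  by auto

lemma prefix_closed [simp]: "prefix k \<in> carrier P"
  unfolding prefix_def by (rule wprod_closed) simp

lemma reduced_segment: "reduced (i = even j) (map letter [j..<k])"
proof -
  have "letter (j + l) \<in> F ((i = even j) = even l) - C" for l
    using letter_in[of "j + l"] by (cases i; cases "even j") simp_all
  then show ?thesis by (simp add: reduced_iff_nth)
qed

lemma prefix_split: "j \<le> k \<Longrightarrow> prefix k = prefix j \<otimes> wprod (map letter [j..<k])"
  using upt_add_eq_append[of 0 j "k - j"] by (simp add: prefix_def wprod_append)

lemma prefix_0 [simp]: "prefix 0 = \<one>"
  by (simp add: prefix_def)

lemma prefix_Suc: "prefix (Suc k) = prefix k \<otimes> letter k"
  using prefix_split[of k "Suc k"] by simp

lemma segment_period: "map letter [length ws..<length ws + k] = map letter [0..<k]"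
  by (rule nth_equalityI) (auto simp: letter_def)

lemma prefix_period: "prefix (length ws + k) = prefix (length ws) \<otimes> prefix k"
  using prefix_split[of "length ws" "length ws + k"] by (simp add: segment_period prefix_def)

lemma segment_ws: "map letter [0..<length ws] = ws"
  by (rule nth_equalityI) (auto simp: letter_def)

lemma prefix_length: "prefix (length ws) = wprod ws"
  by (simp add: prefix_def segment_ws)

lemma prefix_mult_period: "prefix (n * length ws + k) = prefix (n * length ws) \<otimes> prefix k"
proof (induction n)
  case (Suc n)
  have "prefix (Suc n * length ws + k) = prefix (length ws) \<otimes> prefix (n * length ws + k)"
    using prefix_period[of "n * length ws + k"] by (simp add: add.assoc)
  then show ?case using Suc prefix_period[of "n * length ws"] by (simp add: m_assoc)
qed simp

lemma commute_prefix:
  assumes "commute P (wprod ws) x" "x \<in> carrier P"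
  shows "commute P (prefix (n * length ws)) x"
proof (induction n)
  case 0
  then show ?case using assms by (simp add: commute_def)
next
  case (Suc n)
  then show ?case
    using commute_mult[of "prefix (length ws)" "prefix (n * length ws)" x] assms
      prefix_period[of "n * length ws"] reduced_wprod_closed[OF ws_reduced] by (simp add: prefix_length)
qed

text \<open>If the ray is translated by \<open>x\<close>, only finitely many letters cancel against \<open>x\<close>. The place \<open>j\<close>
  where cancellation has ended is found by minimising the reduced length of \<open>x \<otimes> prefix j\<close>;
  the parity condition says that \<open>us\<close> followed by the rest of the ray is reduced.\<close>

lemma absorb_into_ray:
  assumes x: "x \<in> carrier P"
  obtains j i' us where "us \<noteq> []" "reduced i' us" "x \<otimes> prefix j = wprod us"
    "(i = even j) = (i' = even (length us))"
proof -
  define N where "N n \<longleftrightarrow> (\<exists>j i' us c. length us = n \<and> reduced i' us \<and> c \<in> C \<and>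
    x \<otimes> prefix j = wprod us \<otimes> c)" for n
  obtain i0 us0 c0 where "reduced i0 us0" "c0 \<in> C" "x = wprod us0 \<otimes> c0"
    using exists_reduced_form[OF x] by blast
  then have "N (length us0)" unfolding N_def using x by (metis prefix_0 r_one)
  then have "N (LEAST n. N n)" and min: "\<And>n. N n \<Longrightarrow> (LEAST n. N n) \<le> n"
    by (rule LeastI) (rule Least_le)
  then obtain j i' us c where len: "length us = (LEAST n. N n)" and us: "reduced i' us"
    and c: "c \<in> C" and eq: "x \<otimes> prefix j = wprod us \<otimes> c"
    unfolding N_def by blast
  define z where "z = c \<otimes> letter j"
  have z: "z \<in> F (i = even j)" "z \<notin> C" and zc: "z \<in> carrier P"
    using letter_in[of j] c by (simp_all add: z_def)
  have usc: "set us \<subseteq> carrier P" using reduced_in_carrier[OF us] .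
  have eq': "x \<otimes> prefix (Suc j) = wprod us \<otimes> z"
    using eq x c usc by (simp add: prefix_Suc z_def flip: m_assoc)
  from us z(1) show thesis
  proof (cases rule: reduced_snoc_cases)
    case (extend i'')
    have "reduced i'' (us @ [z])" using extend z by (simp add: reduced_append)
    moreover have "x \<otimes> prefix (Suc j) = wprod (us @ [z])" using eq' zc usc by (simp add: wprod_append)
    moreover have "(i = even (Suc j)) = (i'' = even (length (us @ [z])))" using extend by auto
    ultimately show thesis using that by blast
  next
    case (merge us' y)
    have yc: "y \<in> carrier P" "set us' \<subseteq> carrier P" using usc merge by simp_all
    have eq'': "x \<otimes> prefix (Suc j) = wprod us' \<otimes> (y \<otimes> z)"
      using eq' merge(1) yc zc by (simp add: wprod_append m_assoc)
    have "y \<otimes> z \<notin> C"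
    proof
      assume "y \<otimes> z \<in> C"
      then have "N (length us')" unfolding N_def using merge(2) eq'' by blast
      then show False using min[of "length us'"] len merge(1) by simp
    qed
    then have "reduced i' (us' @ [y \<otimes> z])" using merge z by (simp add: reduced_append)
    moreover have "x \<otimes> prefix (Suc j) = wprod (us' @ [y \<otimes> z])"
      using eq'' zc yc by (simp add: wprod_append)
    moreover have "(i = even (Suc j)) = (i' = even (length (us' @ [y \<otimes> z])))" using merge by auto
    ultimately show thesis using that by blast
  qed
qed

text \<open>From some edge on, \<open>x\<close> translates the ray along itself by \<open>t\<close>. Only the far end matters, so that
  \<open>t\<close> may be negative and is additive in \<open>x\<close>.\<close>

definition shifts :: "'a \<Rightarrow> int \<Rightarrow> bool" where
  "shifts x t \<longleftrightarrow> (\<exists>K. \<forall>k\<ge>K. 0 \<le> int k + t \<and> inv (prefix (nat (int k + t))) \<otimes> (x \<otimes> prefix k) \<in> C)"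

text \<open>If \<open>x\<close> commutes with \<open>a = wprod ws\<close>, the words \<open>V k\<close> for the translated ray satisfy
  \<open>a\<^sup>n V 0 = V (n * length ws)\<close> as group elements. The lengths of both sides agree without any
  cancellation on the left, so both words are reduced words of the same element; comparing
  their prefixes shows that the translated ray eventually runs along the ray itself.\<close>

lemma centraliser_shifts:
  assumes x: "x \<in> carrier P" and comm: "commute P (wprod ws) x"
  shows "\<exists>t. shifts x t"
proof -
  obtain j i' us where us: "us \<noteq> []" "reduced i' us" and xj: "x \<otimes> prefix j = wprod us"
    and par: "(i = even j) = (i' = even (length us))"
    using absorb_into_ray[OF x] by blast
  define V where "V k = us @ map letter [j..<j + k]" for k
  have V: "reduced i' (V k)" for k
    using us reduced_segment[of j "j + k"] par by (simp add: V_def reduced_append)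
  have usc: "set us \<subseteq> carrier P" using reduced_in_carrier[OF us(2)] .
  have wprod_V: "wprod (V k) = x \<otimes> prefix (j + k)" for k
    using usc x xj prefix_split[of j "j + k"] by (simp add: V_def wprod_append flip: m_assoc)
  have shift: "prefix (n * length ws) \<otimes> wprod us = wprod (V (n * length ws))" for n
  proof -
    have "prefix (n * length ws) \<otimes> (x \<otimes> prefix j) = x \<otimes> (prefix (n * length ws) \<otimes> prefix j)"
      using commute_prefix[OF comm x, of n] x by (simp add: commute_def flip: m_assoc)
    also have "\<dots> = x \<otimes> prefix (j + n * length ws)"
      using prefix_mult_period[of n j] by (simp add: add.commute)
    finally show ?thesis using xj wprod_V by simp
  qed
  \<comment> \<open>If \<open>us\<close> started in the other factor, the inverse of \<open>ws\<close> could be put in front of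
    \<open>V (length ws)\<close> without cancellation, giving a reduced word for \<open>us\<close> that is too long.\<close>
  have "i' = i"
  proof (rule ccontr)
    assume "i' \<noteq> i"
    then have "reduced (i = odd (length ws)) (rev (map (m_inv P) ws) @ V (length ws))"
      using reduced_rev_inv[OF ws_reduced] V[of "length ws"] ws_even
      by (cases i) (simp_all add: reduced_append)
    moreover have "wprod (rev (map (m_inv P) ws) @ V (length ws)) = wprod us"
    proof -
      have "set ws \<subseteq> carrier P" using reduced_in_carrier[OF ws_reduced] .
      moreover from this have "set (rev (map (m_inv P) ws)) \<subseteq> carrier P" by auto
      moreover have "wprod (V (length ws)) = wprod ws \<otimes> wprod us"
        using shift[of 1] by (simp add: prefix_length)
      ultimately show ?thesis
        using reduced_in_carrier[OF V] usc by (simp add: wprod_append wprod_rev_inv)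
    qed
    ultimately have "length (rev (map (m_inv P) ws) @ V (length ws)) = length us"
      by (rule reduced_unique_eq(1)[OF _ us(2)])
    then show False using ws_nonempty by (simp add: V_def)
  qed
  have key: "inv (prefix (length us + q)) \<otimes> (x \<otimes> prefix (j + q)) \<in> C" for q
  proof -
    define n where "n = length us + q"
    define W where "W = map letter [0..<n * length ws] @ us"
    have n: "n \<le> n * length ws" using ws_nonempty by (cases ws) simp_all
    have "reduced i W"
      using reduced_segment[of 0 "n * length ws"] us(2) \<open>i' = i\<close> ws_even
      by (simp add: W_def reduced_append)
    moreover have "wprod W = wprod (V (n * length ws))"
      using usc by (simp add: W_def wprod_append shift flip: prefix_def)
    ultimately have "inv (wprod (take n W)) \<otimes> wprod (take n (V (n * length ws))) \<in> C"
      using reduced_unique_eq(3)[OF _ V] by blast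
    moreover have "take n W = map letter [0..<n]" using n by (simp add: W_def take_map)
    moreover have "take n (V (n * length ws)) = V q"
    proof -
      have "j + q \<le> j + n * length ws" using n unfolding n_def by linarith
      then have "take q [j..<j + n * length ws] = [j..<j + q]" by (rule take_upt)
      then show ?thesis by (simp add: V_def n_def take_map)
    qed
    ultimately show ?thesis using wprod_V by (simp add: n_def flip: prefix_def)
  qed
  have "shifts x (int (length us) - int j)"
    unfolding shifts_def
  proof (intro exI[of _ j] allI impI)
    fix k assume "j \<le> k"
    then obtain q where q: "k = j + q" using le_Suc_ex by blast
    then have "int k + (int (length us) - int j) = int (length us + q)" by simp
    then show "0 \<le> int k + (int (length us) - int j) \<and>
      inv (prefix (nat (int k + (int (length us) - int j)))) \<otimes> (x \<otimes> prefix k) \<in> C"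
      using key[of q] q by (simp only: nat_int) simp
  qed
  then show ?thesis by blast
qed

lemma shifts_mult:
  assumes "shifts x t" "shifts y t'" and xy: "x \<in> carrier P" "y \<in> carrier P"
  shows "shifts (x \<otimes> y) (t + t')"
proof -
  obtain K K' where K: "\<And>k. K \<le> k \<Longrightarrow> 0 \<le> int k + t \<and> inv (prefix (nat (int k + t))) \<otimes> (x \<otimes> prefix k) \<in> C"
    and K': "\<And>k. K' \<le> k \<Longrightarrow> 0 \<le> int k + t' \<and> inv (prefix (nat (int k + t'))) \<otimes> (y \<otimes> prefix k) \<in> C"
    using assms(1,2) unfolding shifts_def by blast
  show ?thesis unfolding shifts_def
  proof (intro exI[of _ "max K' (K + nat \<bar>t'\<bar>)"] allI impI)
    fix k assume k: "max K' (K + nat \<bar>t'\<bar>) \<le> k"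
    define k' where "k' = nat (int k + t')"
    have *: "0 \<le> int k + t'" "inv (prefix k') \<otimes> (y \<otimes> prefix k) \<in> C"
      using K'[of k] k by (simp_all add: k'_def)
    then have "K \<le> k'" and int_k': "int k' = int k + t'" using k by (auto simp: k'_def)
    then have **: "0 \<le> int k' + t" "inv (prefix (nat (int k' + t))) \<otimes> (x \<otimes> prefix k') \<in> C"
      using K[of k'] by auto
    have "(inv (prefix (nat (int k' + t))) \<otimes> (x \<otimes> prefix k')) \<otimes> (inv (prefix k') \<otimes> (y \<otimes> prefix k)) \<in> C"
      using * ** by simp
    then show "0 \<le> int k + (t + t') \<and>
        inv (prefix (nat (int k + (t + t')))) \<otimes> (x \<otimes> y \<otimes> prefix k) \<in> C"
      using **(1) int_k' xy by (simp add: m_assoc algebra_simps)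
  qed
qed

lemma shifts_inv:
  assumes "shifts x t" and x: "x \<in> carrier P"
  shows "shifts (inv x) (- t)"
proof -
  obtain K where K: "\<And>k. K \<le> k \<Longrightarrow> 0 \<le> int k + t \<and> inv (prefix (nat (int k + t))) \<otimes> (x \<otimes> prefix k) \<in> C"
    using assms(1) unfolding shifts_def by blast
  show ?thesis unfolding shifts_def
  proof (intro exI[of _ "K + nat \<bar>t\<bar>"] allI impI)
    fix k assume k: "K + nat \<bar>t\<bar> \<le> k"
    define k' where "k' = nat (int k + - t)"
    have k': "0 \<le> int k + - t" "K \<le> k'" "nat (int k' + t) = k" using k by (auto simp: k'_def)
    then have "inv (prefix k) \<otimes> (x \<otimes> prefix k') \<in> C" using K[of k'] by simp
    then have "inv (inv (prefix k) \<otimes> (x \<otimes> prefix k')) \<in> C" by simp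
    then show "0 \<le> int k + - t \<and> inv (prefix (nat (int k + - t))) \<otimes> (inv x \<otimes> prefix k) \<in> C"
      using k'(1) x by (simp add: inv_mult_group m_assoc k'_def)
  qed
qed

text \<open>Such an element fixes all edges of the ray from some point on, in particular two consecutive
  ones that are separated by a letter of the first factor; malnormality of \<open>C\<close> applies.\<close>

lemma shifts_0_imp_one:
  assumes "shifts x 0" and x: "x \<in> carrier P"
  shows "x = \<one>"
proof -
  obtain K where K: "\<And>k. K \<le> k \<Longrightarrow> inv (prefix k) \<otimes> (x \<otimes> prefix k) \<in> C"
    using assms(1) unfolding shifts_def by auto
  define k where "k = (if i = even K then K else Suc K)"
  have k: "K \<le> k" "i = even k" by (auto simp: k_def)
  define c where "c = inv (prefix k) \<otimes> (x \<otimes> prefix k)"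
  have "letter k \<in> F True - C" using letter_in[of k] k(2) by simp
  moreover have "c \<in> C" using K[OF k(1)] by (simp add: c_def)
  moreover have "inv (letter k) \<otimes> (c \<otimes> letter k) = inv (prefix (Suc k)) \<otimes> (x \<otimes> prefix (Suc k))"
    using x by (simp add: c_def prefix_Suc inv_mult_group m_assoc)
  then have "inv (letter k) \<otimes> (c \<otimes> letter k) \<in> C" using K[of "Suc k"] k(1) by simp
  ultimately have "c = \<one>" by (intro C_malnormal)
  then show ?thesis using conj_eq_one_iff[of "inv (prefix k)" x] x by (simp add: c_def)
qed

lemma prefix_cosets_distinct:
  assumes "j < k"
  shows "inv (prefix j) \<otimes> prefix k \<notin> C"
proof -
  have "inv (prefix j) \<otimes> prefix k = wprod (map letter [j..<k])"
    using prefix_split[of j k] assms by simp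
  then show ?thesis using reduced_wprod_notin_C[OF reduced_segment, of j k] assms by simp
qed

lemma shifts_unique:
  assumes "shifts x t" "shifts x t'" and x: "x \<in> carrier P"
  shows "t = t'"
proof -
  have no_less: False if less: "shifts x t" "shifts x t'" "t < t'" for t t'
  proof -
    obtain K K' where "\<And>k. K \<le> k \<Longrightarrow> 0 \<le> int k + t \<and> inv (prefix (nat (int k + t))) \<otimes> (x \<otimes> prefix k) \<in> C"
      "\<And>k. K' \<le> k \<Longrightarrow> 0 \<le> int k + t' \<and> inv (prefix (nat (int k + t'))) \<otimes> (x \<otimes> prefix k) \<in> C"
      using less(1,2) unfolding shifts_def by blast
    from this(1)[of "max K K'"] this(2)[of "max K K'"] obtain k where
      k: "0 \<le> int k + t" "inv (prefix (nat (int k + t))) \<otimes> (x \<otimes> prefix k) \<in> C"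
        "inv (prefix (nat (int k + t'))) \<otimes> (x \<otimes> prefix k) \<in> C" by auto
    have "(inv (prefix (nat (int k + t))) \<otimes> (x \<otimes> prefix k)) \<otimes>
        inv (inv (prefix (nat (int k + t'))) \<otimes> (x \<otimes> prefix k)) \<in> C"
      using k by simp
    then have "inv (prefix (nat (int k + t))) \<otimes> prefix (nat (int k + t')) \<in> C"
      using x by (simp add: inv_mult_group m_assoc)
    then show False using prefix_cosets_distinct[of "nat (int k + t)" "nat (int k + t')"] k(1) less(3)
      by simp
  qed
  then show ?thesis using assms by (metis linorder_neqE)
qed

text \<open>Translation lengths along the ray embed the centraliser \<open>Z\<close> of \<open>a = wprod ws\<close> into the integers,
  so \<open>Z\<close> is abelian. If \<open>a\<close> commutes with its conjugate by \<open>g\<close>, then \<open>g\<close> normalises \<open>Z\<close> and acts on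
  it by a sign. If the sign were \<open>-1\<close>, the square of \<open>g\<close> would be an element of \<open>Z\<close>
  that \<open>g\<close> both fixes and inverts, so \<open>g\<close> would be an involution.\<close>

lemma csa_at_cyclically_reduced:
  assumes no_involution: "\<And>g. g \<in> carrier P \<Longrightarrow> g \<otimes> g = \<one> \<Longrightarrow> g = \<one>"
  shows "csa_at P (carrier P) (wprod ws)"
proof -
  define a where "a = wprod ws"
  have a: "a \<in> carrier P" using ws_reduced by (simp add: a_def)
  have "a \<noteq> \<one>" using reduced_wprod_notin_C[OF ws_reduced ws_nonempty] C_closed(4) by (auto simp: a_def)
  define Z where "Z = {x \<in> carrier P. commute P a x}"
  have Z_carrier: "x \<in> carrier P" if "x \<in> Z" for x using that by (simp add: Z_def)
  have aZ: "a \<in> Z" using a by (simp add: Z_def commute_def)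
  have Z: "subgroup Z P"
  proof
    show "x \<otimes> y \<in> Z" if "x \<in> Z" "y \<in> Z" for x y
      using that commute_mult[of x y a] a commute_sym by (auto simp: Z_def)
    show "inv x \<in> Z" if "x \<in> Z" for x
      using that commute_inv[of x a] a commute_sym by (auto simp: Z_def)
  qed (use a in \<open>auto simp: Z_def commute_def\<close>)
  define \<beta> where "\<beta> x = (THE t. shifts x t)" for x
  have \<beta>: "shifts x (\<beta> x)" if x: "x \<in> Z" for x
  proof -
    have "\<exists>t. shifts x t" using centraliser_shifts[of x] x by (simp add: Z_def a_def)
    then show ?thesis unfolding \<beta>_def using shifts_unique Z_carrier[OF x] by (metis theI)
  qed
  have hom: "\<beta> (x \<otimes> y) = \<beta> x + \<beta> y" if "x \<in> Z" "y \<in> Z" for x y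
    using shifts_unique[OF \<beta>[OF subgroup.m_closed[OF Z that]] shifts_mult[OF \<beta> \<beta>]] that Z_carrier by simp
  have inj: "x = \<one>" if "x \<in> Z" "\<beta> x = 0" for x
    using \<beta>[OF that(1)] that shifts_0_imp_one Z_carrier by simp
  have \<beta>_inject: "x = y" if xy: "x \<in> Z" "y \<in> Z" and eq: "\<beta> x = \<beta> y" for x y
  proof -
    have "shifts (x \<otimes> inv y) (\<beta> x + - \<beta> y)"
      by (intro shifts_mult shifts_inv \<beta> xy inv_closed Z_carrier)
    then have "x \<otimes> inv y = \<one>"
      using shifts_0_imp_one[of "x \<otimes> inv y"] eq Z_carrier[OF xy(1)] Z_carrier[OF xy(2)] by simp
    then have "(x \<otimes> inv y) \<otimes> y = y" using Z_carrier[OF xy(2)] by simp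
    then show ?thesis using Z_carrier[OF xy(1)] Z_carrier[OF xy(2)] by (simp add: m_assoc)
  qed
  have comm: "commute P x y" if xy: "x \<in> Z" "y \<in> Z" for x y
    unfolding commute_def
    by (rule \<beta>_inject) (use xy hom subgroup.m_closed[OF Z] in auto)
  have conj_Z: "inv h \<otimes> (x \<otimes> h) \<in> Z"
    if h: "h \<in> carrier P" and c: "commute P a (h \<otimes> (a \<otimes> inv h))" and x: "x \<in> Z" for h x
  proof -
    have "h \<otimes> (a \<otimes> inv h) \<in> Z" using a h c by (simp add: Z_def)
    from comm[OF this x] have "(h \<otimes> (a \<otimes> inv h)) \<otimes> x = x \<otimes> (h \<otimes> (a \<otimes> inv h))"
      by (simp add: commute_def)
    then have "inv h \<otimes> (((h \<otimes> (a \<otimes> inv h)) \<otimes> x) \<otimes> h) = inv h \<otimes> ((x \<otimes> (h \<otimes> (a \<otimes> inv h))) \<otimes> h)"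
      by simp
    then show ?thesis using a h Z_carrier[OF x] by (simp add: Z_def commute_def m_assoc)
  qed
  have "commute P a g" if g: "g \<in> carrier P" and ab: "commute P a (g \<otimes> (a \<otimes> inv g))" for g
  proof -
    define b where "b = g \<otimes> (a \<otimes> inv g)"
    have b: "b \<in> Z" "b \<in> carrier P" using ab a g by (simp_all add: Z_def b_def)
    have "inv g \<otimes> ((a \<otimes> b) \<otimes> g) = inv g \<otimes> ((b \<otimes> a) \<otimes> g)"
      using ab by (simp add: commute_def b_def)
    then have ab': "commute P a (inv g \<otimes> (a \<otimes> inv (inv g)))"
      using a g by (simp add: b_def commute_def m_assoc)
    have gZ: "g \<otimes> (x \<otimes> inv g) \<in> Z" if "x \<in> Z" for x
      using conj_Z[OF inv_closed[OF g] ab' that] g by simp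
    obtain k where k: "k = 1 \<or> k = -1" "\<And>x. x \<in> Z \<Longrightarrow> \<beta> (g \<otimes> (x \<otimes> inv g)) = k * \<beta> x"
      using conjugation_acts_by_sign[OF Z hom inj g gZ conj_Z[OF g ab] aZ \<open>a \<noteq> \<one>\<close>] by blast
    from k(1) show ?thesis
    proof
      assume "k = 1"
      then have "b = a" using k(2)[OF aZ] \<beta>_inject[OF b(1) aZ] by (simp add: b_def)
      then show ?thesis using commute_iff_conj[OF g a] by (simp add: b_def)
    next
      assume "k = -1"
      have "\<beta> (inv a) = - \<beta> a"
        using shifts_unique[OF \<beta> shifts_inv[OF \<beta>[OF aZ] a]] subgroup.m_inv_closed[OF Z aZ] a by simp
      then have b_inv: "b = inv a"
        using k(2)[OF aZ] \<beta>_inject[OF b(1) subgroup.m_inv_closed[OF Z aZ]] \<open>k = -1\<close> by (simp add: b_def)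
      have "(g \<otimes> g) \<otimes> (a \<otimes> inv (g \<otimes> g)) = g \<otimes> (b \<otimes> inv g)"
        using g a by (simp add: b_def m_assoc inv_mult_group)
      also have "\<dots> = inv b" using g a unfolding b_inv by (simp add: b_inv[symmetric] b_def m_assoc inv_mult_group)
      finally have gg: "g \<otimes> g \<in> Z"
        using commute_iff_conj[of "g \<otimes> g" a] g a by (simp add: Z_def b_inv)
      have "g \<otimes> ((g \<otimes> g) \<otimes> inv g) = g \<otimes> g" using g by (simp add: m_assoc)
      then have "\<beta> (g \<otimes> g) = - \<beta> (g \<otimes> g)" using k(2)[OF gg] \<open>k = -1\<close> by simp
      then have "g \<otimes> g = \<one>" using inj[OF gg] by simp
      then have "g = \<one>" using no_involution g by blast
      then show ?thesis using a by (simp add: commute_def)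
    qed
  qed
  then show ?thesis using comm unfolding csa_at_def a_def Z_def by blast
qed

end


section \<open>The CSA property of an internal amalgam\<close>

context malnormal_amalgam
begin

text \<open>The square of a nonempty cyclically reduced word is again a nonempty reduced word, so an
  involution is conjugate into a factor.\<close>

lemma no_involution:
  assumes factor: "\<And>f x. x \<in> F f \<Longrightarrow> x \<otimes> x = \<one> \<Longrightarrow> x = \<one>"
    and g: "g \<in> carrier P" "g \<otimes> g = \<one>"
  shows "g = \<one>"
proof -
  obtain h y where h: "h \<in> carrier P" and y: "g = h \<otimes> (y \<otimes> inv h)"
    and cases: "(\<exists>f. y \<in> F f) \<or> (\<exists>i ws. reduced i ws \<and> ws \<noteq> [] \<and> even (length ws) \<and> y = wprod ws)"
    using cyclic_reduction[OF g(1)] by blast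
  have yc: "y \<in> carrier P"
    using cases factor_closed(1) reduced_wprod_closed by blast
  have "g \<otimes> g = h \<otimes> ((y \<otimes> y) \<otimes> inv h)" using y yc h by (simp add: m_assoc)
  then have yy: "y \<otimes> y = \<one>" using g(2) conj_eq_one_iff[of h "y \<otimes> y"] yc h by simp
  have "\<exists>f. y \<in> F f"
  proof (rule ccontr)
    assume "\<nexists>f. y \<in> F f"
    then obtain i ws where ws: "reduced i ws" "ws \<noteq> []" "even (length ws)" "y = wprod ws"
      using cases by blast
    have "reduced i (ws @ ws)" using ws by (simp add: reduced_append)
    then have "wprod (ws @ ws) \<notin> C" using reduced_wprod_notin_C ws(2) by blast
    then show False using yy ws reduced_in_carrier[OF ws(1)] by (simp add: wprod_append)
  qed
  then have "y = \<one>" using factor yy by blast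
  then show ?thesis using y h by simp
qed

lemma CSA_star_group_if_factors:
  assumes csa: "\<And>f a. a \<in> F f \<Longrightarrow> a \<noteq> \<one> \<Longrightarrow> csa_at P (F f) a"
    and factor: "\<And>f x. x \<in> F f \<Longrightarrow> x \<otimes> x = \<one> \<Longrightarrow> x = \<one>"
  shows "CSA_star_group P"
proof -
  have no_involution: "g = \<one>" if "g \<in> carrier P" "g \<otimes> g = \<one>" for g
    using no_involution[OF factor that] .
  have "csa_at P (carrier P) a" if a: "a \<in> carrier P" "a \<noteq> \<one>" for a
  proof -
    obtain h y where h: "h \<in> carrier P" and y: "a = h \<otimes> (y \<otimes> inv h)"
      and cases: "(\<exists>f. y \<in> F f) \<or> (\<exists>i ws. reduced i ws \<and> ws \<noteq> [] \<and> even (length ws) \<and> y = wprod ws)"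
      using cyclic_reduction[OF a(1)] by blast
    have yc: "y \<in> carrier P"
      using cases factor_closed(1) reduced_wprod_closed by blast
    have "y \<noteq> \<one>" using a y h by auto
    have "csa_at P (carrier P) y" using cases
    proof
      assume "\<exists>f. y \<in> F f"
      then show ?thesis using csa_at_in_factor[OF csa] \<open>y \<noteq> \<one>\<close> by blast
    next
      assume "\<exists>i ws. reduced i ws \<and> ws \<noteq> [] \<and> even (length ws) \<and> y = wprod ws"
      then obtain i ws where ws: "reduced i ws" "ws \<noteq> []" "even (length ws)" "y = wprod ws" by blast
      then interpret ray: periodic_ray P F i ws by unfold_locales
      show ?thesis using ray.csa_at_cyclically_reduced[OF no_involution] ws by simp
    qed
    then show ?thesis using csa_at_conj[OF _ yc h] y by simp
  qed
  then show ?thesis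
    using CSA_group_if_csa_at no_involution ord_eq_2_iff unfolding CSA_star_group_def by blast
qed

end


section \<open>The normal form theorem\<close>

text \<open>The subgroup itself is represented by the identity, so that normal forms do not contain
  trivial letters; the choice is otherwise arbitrary, but depends only on the right coset.\<close>

definition coset_rep :: "('k, 'm) monoid_scheme \<Rightarrow> 'k set \<Rightarrow> 'k \<Rightarrow> 'k" where
  "coset_rep K D k = (if k \<in> D then \<one>\<^bsub>K\<^esub> else SOME r. r \<in> D #>\<^bsub>K\<^esub> k)"

text \<open>One factor's share of van der Waerden's argument. A normal form \<open>(c, ls)\<close> consists of an
  element \<open>c\<close> of the amalgamated subgroup and a list of coset representatives alternating between
  the two factors. The lists in \<open>V\<close> are those that do not start with a representative from the
  factor \<open>K\<close>; hence a normal form is the same thing as an element of \<open>carrier K \<times> V\<close>, obtained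
  by multiplying the coefficient with the leading representative if that comes from \<open>K\<close>. Through
  this bijection \<open>encode\<close>, left multiplication in \<open>K\<close> becomes an action on normal forms. The
  amalgamated subgroup acts on coefficients only, so it acts in the same way for both factors.\<close>

locale factor_action = K: group K + A: group A
  for K :: "('k, 'm) monoid_scheme" and A :: "('c, 'n) monoid_scheme" +
  fixes j :: "'c \<Rightarrow> 'k" and tag :: "'k \<Rightarrow> 'l" and V :: "'l list set"
  assumes j_hom: "j \<in> hom A K" and j_inj: "inj_on j (carrier A)"
    and tag_inj: "inj tag" and V_other_tag: "tag k # ls \<notin> V"
begin

definition D :: "'k set" where "D = j ` carrier A"

definition rep :: "'k \<Rightarrow> 'k" where "rep = coset_rep K D"

definition coeff :: "'k \<Rightarrow> 'c" where
  "coeff k = the_inv_into (carrier A) j (k \<otimes>\<^bsub>K\<^esub> inv\<^bsub>K\<^esub> rep k)"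

definition encode :: "'k \<times> 'l list \<Rightarrow> 'c \<times> 'l list" where
  "encode = (\<lambda>(k, ls). (coeff k, if rep k = \<one>\<^bsub>K\<^esub> then ls else tag (rep k) # ls))"

definition states :: "('c \<times> 'l list) set" where
  "states = carrier A \<times> (V \<union> {tag r # ls | r ls. r \<in> rep ` carrier K - {\<one>\<^bsub>K\<^esub>} \<and> ls \<in> V})"

definition act :: "'k \<Rightarrow> 'c \<times> 'l list \<Rightarrow> 'c \<times> 'l list" where
  "act k s = (case inv_into (carrier K \<times> V) encode s of (k', ls) \<Rightarrow> encode (k \<otimes>\<^bsub>K\<^esub> k', ls))"

lemma j_simps [simp]:
  "c \<in> carrier A \<Longrightarrow> j c \<in> carrier K"
  "c \<in> carrier A \<Longrightarrow> c' \<in> carrier A \<Longrightarrow> j (c \<otimes>\<^bsub>A\<^esub> c') = j c \<otimes>\<^bsub>K\<^esub> j c'"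
  "c \<in> carrier A \<Longrightarrow> j c \<in> D"
  using j_hom by (auto simp: hom_def D_def)

lemma D_subgroup: "subgroup D K"
proof -
  interpret group_hom A K j using j_hom by unfold_locales
  show ?thesis unfolding D_def by (rule img_is_subgroup)
qed

lemma D_closed: "d \<in> D \<Longrightarrow> d \<in> carrier K"
  using D_subgroup by (rule subgroup.mem_carrier)

lemma rep_in_coset:
  assumes "k \<in> carrier K"
  obtains d where "d \<in> D" "rep k = d \<otimes>\<^bsub>K\<^esub> k"
proof -
  have "rep k \<in> D #>\<^bsub>K\<^esub> k"
  proof (cases "k \<in> D")
    case True
    then have "rep k = inv\<^bsub>K\<^esub> k \<otimes>\<^bsub>K\<^esub> k" "inv\<^bsub>K\<^esub> k \<in> D"
      using assms subgroup.m_inv_closed[OF D_subgroup] by (simp_all add: rep_def coset_rep_def)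
    then show ?thesis unfolding r_coset_def by blast
  next
    case False
    have "k \<in> D #>\<^bsub>K\<^esub> k" using K.rcos_self[OF assms D_subgroup] .
    then show ?thesis using False unfolding rep_def coset_rep_def by (auto intro: someI)
  qed
  then show thesis using that unfolding r_coset_def by blast
qed

lemma rep_closed [simp]: "k \<in> carrier K \<Longrightarrow> rep k \<in> carrier K"
  by (metis rep_in_coset D_closed K.m_closed)

lemma rep_D_mult:
  assumes "d \<in> D" "k \<in> carrier K"
  shows "rep (d \<otimes>\<^bsub>K\<^esub> k) = rep k"
proof -
  have "d \<otimes>\<^bsub>K\<^esub> k \<in> D \<longleftrightarrow> k \<in> D"
  proof
    assume "d \<otimes>\<^bsub>K\<^esub> k \<in> D"
    then have "inv\<^bsub>K\<^esub> d \<otimes>\<^bsub>K\<^esub> (d \<otimes>\<^bsub>K\<^esub> k) \<in> D"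
      using assms subgroup.m_closed[OF D_subgroup] subgroup.m_inv_closed[OF D_subgroup] by blast
    then show "k \<in> D" using assms D_closed by simp
  qed (use assms subgroup.m_closed[OF D_subgroup] in blast)
  moreover have "D #>\<^bsub>K\<^esub> (d \<otimes>\<^bsub>K\<^esub> k) = D #>\<^bsub>K\<^esub> k"
    using K.repr_independence[of "d \<otimes>\<^bsub>K\<^esub> k" D k] assms D_subgroup unfolding r_coset_def by blast
  ultimately show ?thesis by (simp add: rep_def coset_rep_def)
qed

lemma rep_rep: "k \<in> carrier K \<Longrightarrow> rep (rep k) = rep k"
  by (metis rep_in_coset rep_D_mult)

lemma rep_eq_one_iff:
  assumes "k \<in> carrier K"
  shows "rep k = \<one>\<^bsub>K\<^esub> \<longleftrightarrow> k \<in> D"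
proof
  assume 1: "rep k = \<one>\<^bsub>K\<^esub>"
  obtain d where d: "d \<in> D" "rep k = d \<otimes>\<^bsub>K\<^esub> k" using rep_in_coset[OF assms] .
  then have "inv\<^bsub>K\<^esub> d \<otimes>\<^bsub>K\<^esub> (d \<otimes>\<^bsub>K\<^esub> k) = inv\<^bsub>K\<^esub> d \<otimes>\<^bsub>K\<^esub> \<one>\<^bsub>K\<^esub>" using 1 by simp
  then have "k = inv\<^bsub>K\<^esub> d" using d assms D_closed by simp
  then show "k \<in> D" using d subgroup.m_inv_closed[OF D_subgroup] by simp
qed (simp add: rep_def coset_rep_def)

lemma coeff_decomposition:
  assumes "k \<in> carrier K"
  shows "coeff k \<in> carrier A" "j (coeff k) \<otimes>\<^bsub>K\<^esub> rep k = k"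
proof -
  obtain d where d: "d \<in> D" "rep k = d \<otimes>\<^bsub>K\<^esub> k" using rep_in_coset[OF assms] .
  then have "k \<otimes>\<^bsub>K\<^esub> inv\<^bsub>K\<^esub> rep k = inv\<^bsub>K\<^esub> d"
    using assms D_closed by (simp add: K.inv_mult_group)
  then have kD: "k \<otimes>\<^bsub>K\<^esub> inv\<^bsub>K\<^esub> rep k \<in> j ` carrier A"
    using d subgroup.m_inv_closed[OF D_subgroup] by (simp add: D_def)
  show "coeff k \<in> carrier A"
    unfolding coeff_def using the_inv_into_into[OF j_inj kD] by blast
  have "j (coeff k) = k \<otimes>\<^bsub>K\<^esub> inv\<^bsub>K\<^esub> rep k"
    unfolding coeff_def by (rule f_the_inv_into_f[OF j_inj kD])
  then show "j (coeff k) \<otimes>\<^bsub>K\<^esub> rep k = k" using assms by (simp add: K.m_assoc)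
qed

lemma coeff_j_mult:
  assumes "c \<in> carrier A" "k \<in> carrier K"
  shows "coeff (j c \<otimes>\<^bsub>K\<^esub> k) = c \<otimes>\<^bsub>A\<^esub> coeff k"
proof -
  let ?k = "j c \<otimes>\<^bsub>K\<^esub> k"
  have k: "?k \<in> carrier K" using assms by simp
  have "j (coeff ?k) \<otimes>\<^bsub>K\<^esub> rep k = j c \<otimes>\<^bsub>K\<^esub> (j (coeff k) \<otimes>\<^bsub>K\<^esub> rep k)"
    using coeff_decomposition[OF k] coeff_decomposition[OF assms(2)] rep_D_mult[of "j c" k] assms by simp
  then have "j (coeff ?k) \<otimes>\<^bsub>K\<^esub> rep k = j (c \<otimes>\<^bsub>A\<^esub> coeff k) \<otimes>\<^bsub>K\<^esub> rep k"
    using coeff_decomposition(1)[OF assms(2)] assms by (simp add: K.m_assoc)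
  then have "j (coeff ?k) = j (c \<otimes>\<^bsub>A\<^esub> coeff k)"
    using coeff_decomposition(1)[OF k] coeff_decomposition(1)[OF assms(2)] assms by simp
  then show ?thesis
    using j_inj coeff_decomposition(1)[OF k] coeff_decomposition(1)[OF assms(2)] assms
    by (simp add: inj_on_def)
qed

lemma coeff_rep:
  assumes "k \<in> carrier K"
  shows "coeff (rep k) = \<one>\<^bsub>A\<^esub>"
proof -
  have c: "coeff (rep k) \<in> carrier A" and eq: "j (coeff (rep k)) \<otimes>\<^bsub>K\<^esub> rep k = rep k"
    using coeff_decomposition[of "rep k"] rep_rep assms by simp_all
  have "j (coeff (rep k)) = j \<one>\<^bsub>A\<^esub>"
    using eq c assms hom_one[OF j_hom A.is_group K.is_group] by simp
  then show ?thesis using j_inj c by (simp add: inj_on_def)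
qed

lemma encode_j:
  assumes "c \<in> carrier A"
  shows "encode (j c, ls) = (c, ls)"
proof -
  have "rep \<one>\<^bsub>K\<^esub> = \<one>\<^bsub>K\<^esub>"
    using subgroup.one_closed[OF D_subgroup] by (simp add: rep_eq_one_iff)
  then have "coeff (j c) = c" using coeff_j_mult[OF assms, of "\<one>\<^bsub>K\<^esub>"] coeff_rep[of "\<one>\<^bsub>K\<^esub>"] assms by simp
  moreover have "rep (j c) = \<one>\<^bsub>K\<^esub>" using assms by (simp add: rep_eq_one_iff)
  ultimately show ?thesis by (simp add: encode_def)
qed

lemma encode_bij: "bij_betw encode (carrier K \<times> V) states"
proof (rule bij_betw_imageI)
  show "inj_on encode (carrier K \<times> V)"
  proof (rule inj_onI)
    fix s s' assume s: "s \<in> carrier K \<times> V" and s': "s' \<in> carrier K \<times> V" and eq: "encode s = encode s'"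
    obtain k ls k' ls' where [simp]: "s = (k, ls)" "s' = (k', ls')" by (cases s, cases s')
    have *: "k \<in> carrier K" "k' \<in> carrier K" "ls \<in> V" "ls' \<in> V" using s s' by simp_all
    have lists: "(if rep k = \<one>\<^bsub>K\<^esub> then ls else tag (rep k) # ls) =
        (if rep k' = \<one>\<^bsub>K\<^esub> then ls' else tag (rep k') # ls')" and coeffs: "coeff k = coeff k'"
      using eq by (simp_all add: encode_def)
    have "rep k = rep k' \<and> ls = ls'"
    proof (cases "rep k = \<one>\<^bsub>K\<^esub>"; cases "rep k' = \<one>\<^bsub>K\<^esub>")
      assume "rep k = \<one>\<^bsub>K\<^esub>" "rep k' \<noteq> \<one>\<^bsub>K\<^esub>"
      then show ?thesis using lists *(3) V_other_tag[of "rep k'" ls'] by simp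
    next
      assume "rep k \<noteq> \<one>\<^bsub>K\<^esub>" "rep k' = \<one>\<^bsub>K\<^esub>"
      then show ?thesis using lists *(4) V_other_tag[of "rep k" ls] by simp
    qed (use lists inj_eq[OF tag_inj] in simp_all)
    moreover from this have "k = k'"
      using coeffs coeff_decomposition(2)[OF *(1)] coeff_decomposition(2)[OF *(2)] by metis
    ultimately show "s = s'" by simp
  qed
  show "encode ` (carrier K \<times> V) = states"
  proof (intro equalityI subsetI)
    fix s assume "s \<in> encode ` (carrier K \<times> V)"
    then obtain k ls where k: "k \<in> carrier K" "ls \<in> V" "s = encode (k, ls)" by blast
    show "s \<in> states"
    proof (cases "rep k = \<one>\<^bsub>K\<^esub>")
      case True
      then show ?thesis using coeff_decomposition(1)[OF k(1)] k by (simp add: states_def encode_def)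
    next
      case False
      then have "s = (coeff k, tag (rep k) # ls)" using k(3) by (simp add: encode_def)
      then show ?thesis using coeff_decomposition(1)[OF k(1)] k(1,2) False unfolding states_def by blast
    qed
  next
    fix s assume "s \<in> states"
    then obtain c ls where s: "s = (c, ls)" "c \<in> carrier A"
      and "ls \<in> V \<or> (\<exists>k ls'. ls = tag (rep k) # ls' \<and> k \<in> carrier K \<and> rep k \<noteq> \<one>\<^bsub>K\<^esub> \<and> ls' \<in> V)"
      unfolding states_def by auto
    from this(3) show "s \<in> encode ` (carrier K \<times> V)"
    proof (elim disjE exE conjE)
      assume "ls \<in> V"
      then show ?thesis using s encode_j[OF s(2), of ls] by (intro image_eqI[of _ _ "(j c, ls)"]) auto
    next
      fix k ls' assume k: "ls = tag (rep k) # ls'" "k \<in> carrier K" "rep k \<noteq> \<one>\<^bsub>K\<^esub>" "ls' \<in> V"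
      have "encode (j c \<otimes>\<^bsub>K\<^esub> rep k, ls') = s"
        using k s by (simp add: encode_def coeff_j_mult coeff_rep rep_D_mult rep_rep)
      then show ?thesis using k s by (intro image_eqI[of _ _ "(j c \<otimes>\<^bsub>K\<^esub> rep k, ls')"]) auto
    qed
  qed
qed

lemma encode_in_states: "k \<in> carrier K \<Longrightarrow> ls \<in> V \<Longrightarrow> encode (k, ls) \<in> states"
  using bij_betwE[OF encode_bij] by simp

lemma states_cases:
  assumes "s \<in> states"
  obtains k ls where "k \<in> carrier K" "ls \<in> V" "s = encode (k, ls)"
  using assms bij_betw_imp_surj_on[OF encode_bij] by (metis (no_types, lifting) SigmaE imageE)

lemma act_encode:
  "k' \<in> carrier K \<Longrightarrow> ls \<in> V \<Longrightarrow> act k (encode (k', ls)) = encode (k \<otimes>\<^bsub>K\<^esub> k', ls)"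
  using inv_into_f_f[OF bij_betw_imp_inj_on[OF encode_bij], of "(k', ls)"] by (simp add: act_def)

lemma act_closed: "k \<in> carrier K \<Longrightarrow> s \<in> states \<Longrightarrow> act k s \<in> states"
  by (elim states_cases) (simp add: act_encode encode_in_states)

lemma act_mult:
  "k \<in> carrier K \<Longrightarrow> k' \<in> carrier K \<Longrightarrow> s \<in> states \<Longrightarrow> act (k \<otimes>\<^bsub>K\<^esub> k') s = act k (act k' s)"
  by (elim states_cases) (simp add: act_encode K.m_assoc)

lemma act_one: "s \<in> states \<Longrightarrow> act \<one>\<^bsub>K\<^esub> s = s"
  by (elim states_cases) (simp add: act_encode)

lemma act_j:
  assumes "c \<in> carrier A" "(c', ls) \<in> states"
  shows "act (j c) (c', ls) = (c \<otimes>\<^bsub>A\<^esub> c', ls)"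
proof -
  obtain k ls' where k: "k \<in> carrier K" "ls' \<in> V" "(c', ls) = encode (k, ls')"
    using states_cases[OF assms(2)] .
  then show ?thesis
    using assms(1) by (simp add: act_encode) (simp add: encode_def coeff_j_mult rep_D_mult)
qed

lemma act_extends:
  assumes "k \<in> carrier K" "k \<notin> D" "c \<in> carrier A" "ls \<in> V"
  obtains c' r where "c' \<in> carrier A" "r \<in> rep ` carrier K - {\<one>\<^bsub>K\<^esub>}" "act k (c, ls) = (c', tag r # ls)"
proof -
  define k' where "k' = k \<otimes>\<^bsub>K\<^esub> j c"
  have k': "k' \<in> carrier K" using assms by (simp add: k'_def)
  have "act k (c, ls) = encode (k', ls)"
    using act_encode[of "j c" ls k] encode_j[of c ls] assms by (simp add: k'_def)
  moreover have "k' \<notin> D"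
  proof
    assume "k' \<in> D"
    then have "k' \<otimes>\<^bsub>K\<^esub> inv\<^bsub>K\<^esub> j c \<in> D"
      using assms subgroup.m_closed[OF D_subgroup] subgroup.m_inv_closed[OF D_subgroup] by simp
    then show False using assms by (simp add: k'_def K.m_assoc)
  qed
  then have "rep k' \<noteq> \<one>\<^bsub>K\<^esub>" using rep_eq_one_iff k' by simp
  ultimately have "act k (c, ls) = (coeff k', tag (rep k') # ls)" by (simp add: encode_def)
  then show thesis using that[of "coeff k'" "rep k'"] coeff_decomposition(1)[OF k'] k' \<open>rep k' \<noteq> \<one>\<^bsub>K\<^esub>\<close>
    by blast
qed

lemma act_injective_at_base:
  assumes "k \<in> carrier K" "k' \<in> carrier K" "[] \<in> V" "act k (\<one>\<^bsub>A\<^esub>, []) = act k' (\<one>\<^bsub>A\<^esub>, [])"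
  shows "k = k'"
proof -
  have "act x (\<one>\<^bsub>A\<^esub>, []) = encode (x, [])" if "x \<in> carrier K" for x
    using act_encode[of "j \<one>\<^bsub>A\<^esub>" "[]" x] encode_j[of "\<one>\<^bsub>A\<^esub>" "[]"] that assms(3)
      hom_one[OF j_hom A.is_group K.is_group] by simp
  then have "encode (k, []) = encode (k', [])" using assms by simp
  then show ?thesis using inj_onD[OF bij_betw_imp_inj_on[OF encode_bij], of "(k, [])" "(k', [])"] assms
    by simp
qed

end

text \<open>The actions of both factors on the common set of normal forms satisfy all the defining relations of
  the amalgamated product, and a reduced word of length \<open>n\<close> takes the trivial normal form to one with
  \<open>n\<close> representatives.\<close>

locale amalgam_data = G: group G + H: group H
  for G :: "('a, 'm) monoid_scheme" and H :: "('b, 'n) monoid_scheme" +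
  fixes A :: "'a set" and \<phi> :: "'a \<Rightarrow> 'b"
  assumes A_subgroup: "subgroup A G"
    and \<phi>_hom: "\<phi> \<in> hom (G\<lparr>carrier := A\<rparr>) H" and \<phi>_inj: "inj_on \<phi> A"
begin

text \<open>Coefficients of normal forms are taken in \<open>A\<close> for both factors, and \<open>\<phi>\<close> embeds them into \<open>H\<close>;
  this is what makes the two one-factor actions operate on one set.\<close>

definition rest_letters :: "bool \<Rightarrow> ('a + 'b) set" where
  "rest_letters i = (if i then Inl ` (coset_rep G A ` carrier G - {\<one>\<^bsub>G\<^esub>})
     else Inr ` (coset_rep H (\<phi> ` A) ` carrier H - {\<one>\<^bsub>H\<^esub>}))"

primrec rests :: "bool \<Rightarrow> ('a + 'b) list \<Rightarrow> bool" where
  "rests i [] \<longleftrightarrow> True"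
| "rests i (l # ls) \<longleftrightarrow> l \<in> rest_letters i \<and> rests (\<not> i) ls"

lemma A_group: "group (G\<lparr>carrier := A\<rparr>)"
  using subgroup.subgroup_is_group[OF A_subgroup G.is_group] .

lemma A_closed: "a \<in> A \<Longrightarrow> a \<in> carrier G"
  using subgroup.mem_carrier[OF A_subgroup] .

lemma \<phi>_closed: "a \<in> A \<Longrightarrow> \<phi> a \<in> carrier H"
  using \<phi>_hom by (auto simp: hom_def)

interpretation L: factor_action G "G\<lparr>carrier := A\<rparr>" "\<lambda>x. x" Inl "Collect (rests False)"
proof (intro factor_action.intro factor_action_axioms.intro G.is_group A_group)
  show "(\<lambda>x. x) \<in> hom (G\<lparr>carrier := A\<rparr>) G" using A_closed by (auto simp: hom_def)
qed (auto simp: rest_letters_def)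

interpretation R: factor_action H "G\<lparr>carrier := A\<rparr>" \<phi> Inr "Collect (rests True)"
proof (intro factor_action.intro factor_action_axioms.intro H.is_group A_group \<phi>_hom)
  show "inj_on \<phi> (carrier (G\<lparr>carrier := A\<rparr>))" using \<phi>_inj by simp
qed (auto simp: rest_letters_def)

lemma L_D: "L.D = A" and R_D: "R.D = \<phi> ` A"
  by (simp_all add: L.D_def R.D_def)

lemma rest_letters_L: "rest_letters True = Inl ` (L.rep ` carrier G - {\<one>\<^bsub>G\<^esub>})"
  and rest_letters_R: "rest_letters False = Inr ` (R.rep ` carrier H - {\<one>\<^bsub>H\<^esub>})"
  by (simp_all add: rest_letters_def L.rep_def R.rep_def L_D R_D)

definition states :: "('a \<times> ('a + 'b) list) set" where
  "states = A \<times> {ls. \<exists>i. rests i ls}"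

text \<open>Read for both values of \<open>i\<close>, this identifies the normal forms of the two one-factor actions.\<close>

lemma rests_split:
  "{ls. \<exists>i. rests i ls} = Collect (rests (\<not> i)) \<union> {l # ls | l ls. l \<in> rest_letters i \<and> rests (\<not> i) ls}"
proof (intro equalityI subsetI)
  fix ls assume "ls \<in> {ls. \<exists>i. rests i ls}"
  then obtain k where "rests k ls" by blast
  then show "ls \<in> Collect (rests (\<not> i)) \<union> {l # ls | l ls. l \<in> rest_letters i \<and> rests (\<not> i) ls}"
    by (cases "k = i"; cases ls) auto
next
  fix ls assume "ls \<in> Collect (rests (\<not> i)) \<union> {l # ls | l ls. l \<in> rest_letters i \<and> rests (\<not> i) ls}"
  then have "rests (\<not> i) ls \<or> rests i ls" by auto
  then show "ls \<in> {ls. \<exists>i. rests i ls}" by blast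
qed

lemma L_states: "L.states = states"
  using rests_split[of True] unfolding L.states_def states_def rest_letters_L by auto

lemma R_states: "R.states = states"
  using rests_split[of False] unfolding R.states_def states_def rest_letters_R by auto

definition act :: "'a + 'b \<Rightarrow> 'a \<times> ('a + 'b) list \<Rightarrow> 'a \<times> ('a + 'b) list" where
  "act l = (case l of Inl x \<Rightarrow> L.act x | Inr y \<Rightarrow> R.act y)"

definition acts :: "('a + 'b) list \<Rightarrow> 'a \<times> ('a + 'b) list \<Rightarrow> 'a \<times> ('a + 'b) list" where
  "acts = foldr act"

lemma acts_simps [simp]:
  "acts [] s = s" "acts (l # ls) s = act l (acts ls s)" "acts (u @ v) s = acts u (acts v s)"
  by (simp_all add: acts_def)

abbreviation "W \<equiv> amalg_words G H"
abbreviation "rel \<equiv> amalg_rel G H A \<phi>"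

lemma words_simps [simp]:
  "[] \<in> W" "l # u \<in> W \<longleftrightarrow> l \<in> carrier G <+> carrier H \<and> u \<in> W" "u @ v \<in> W \<longleftrightarrow> u \<in> W \<and> v \<in> W"
  by (auto simp: amalg_words_def)

lemma rel_in_words: "(u, v) \<in> rel \<Longrightarrow> u \<in> W \<and> v \<in> W"
  by (induction rule: amalg_rel.induct) (auto simp: A_closed \<phi>_closed)

lemma act_closed: "l \<in> carrier G <+> carrier H \<Longrightarrow> s \<in> states \<Longrightarrow> act l s \<in> states"
  using L.act_closed[of _ s] R.act_closed[of _ s] unfolding L_states R_states by (auto simp: act_def)

lemma acts_closed: "u \<in> W \<Longrightarrow> s \<in> states \<Longrightarrow> acts u s \<in> states"
  by (induction u) (auto intro: act_closed)

text \<open>The relations within a factor hold because each factor acts, and the identification of \<open>a\<close>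
  with \<open>\<phi> a\<close> holds because both change only the coefficient, in the same way.\<close>

lemma rel_acts: "(u, v) \<in> rel \<Longrightarrow> s \<in> states \<Longrightarrow> acts u s = acts v s"
proof (induction arbitrary: s rule: amalg_rel.induct)
  case (append u u' v v')
  have "acts v s \<in> states" using acts_closed rel_in_words append by blast
  then show ?case using append by simp
next
  case one_left
  then show ?case using L.act_one by (simp add: act_def L_states)
next
  case one_right
  then show ?case using R.act_one by (simp add: act_def R_states)
next
  case (mult_left x y)
  then show ?case using L.act_mult by (simp add: act_def L_states)
next
  case (mult_right x y)
  then show ?case using R.act_mult by (simp add: act_def R_states)
next
  case (amalg a)
  obtain c ls where "s = (c, ls)" by (cases s)
  then show ?case using L.act_j[of a c ls] R.act_j[of a c ls] amalg by (simp add: act_def L_states R_states)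
qed simp_all

abbreviation "P \<equiv> amalgamated_product G H A \<phi>"

definition cls :: "('a + 'b) list \<Rightarrow> ('a + 'b) list set" where "cls u = rel `` {u}"

lemma rel_equiv: "equiv W rel"
proof (rule equivI)
  show "rel \<subseteq> W \<times> W" using rel_in_words by auto
  show "refl_on W rel" by (auto simp: refl_on_def intro: amalg_rel.refl)
  show "sym rel" by (auto simp: sym_def intro: amalg_rel.sym)
  show "trans rel" by (auto simp: trans_def intro: amalg_rel.trans)
qed

lemma cls_eqI: "(u, v) \<in> rel \<Longrightarrow> cls u = cls v"
  unfolding cls_def by (rule equiv_class_eq[OF rel_equiv])

lemma cls_eqD: "cls u = cls v \<Longrightarrow> v \<in> W \<Longrightarrow> (u, v) \<in> rel"
  unfolding cls_def by (rule eq_equiv_class[OF _ rel_equiv])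

lemma P_carrier: "carrier P = cls ` W"
  by (auto simp: amalgamated_product_def quotient_def cls_def)

lemma P_one: "\<one>\<^bsub>P\<^esub> = cls []"
  by (simp add: amalgamated_product_def cls_def)

lemma P_mult:
  assumes "u \<in> W" "v \<in> W"
  shows "cls u \<otimes>\<^bsub>P\<^esub> cls v = cls (u @ v)"
proof -
  have "cls (u' @ v') = cls (u @ v)" if "u' \<in> cls u" "v' \<in> cls v" for u' v'
  proof -
    have "(u, u') \<in> rel" "(v, v') \<in> rel" using that by (simp_all add: cls_def)
    then show ?thesis by (rule cls_eqI[OF amalg_rel.sym[OF amalg_rel.append]])
  qed
  moreover have "u \<in> cls u" "v \<in> cls v" using assms by (auto simp: cls_def intro: amalg_rel.refl)
  ultimately have "(\<Union>u'\<in>cls u. \<Union>v'\<in>cls v. cls (u' @ v')) = cls (u @ v)" by blast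
  then show ?thesis by (simp add: amalgamated_product_def cls_def)
qed

lemma cls_append_cong:
  assumes "cls u = cls u'" "cls v = cls v'" "u' \<in> W" "v' \<in> W"
  shows "cls (u @ v) = cls (u' @ v')"
  by (rule cls_eqI[OF amalg_rel.append[OF cls_eqD[OF assms(1,3)] cls_eqD[OF assms(2,4)]]])

definition letter_inv :: "'a + 'b \<Rightarrow> 'a + 'b" where
  "letter_inv l = (case l of Inl x \<Rightarrow> Inl (inv\<^bsub>G\<^esub> x) | Inr y \<Rightarrow> Inr (inv\<^bsub>H\<^esub> y))"

lemma letter_inv:
  assumes "l \<in> carrier G <+> carrier H"
  shows "letter_inv l \<in> carrier G <+> carrier H" "cls [letter_inv l, l] = cls []"
proof -
  show "letter_inv l \<in> carrier G <+> carrier H" using assms by (auto simp: letter_inv_def)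
  show "cls [letter_inv l, l] = cls []"
  proof (cases l)
    case (Inl x)
    then have "([Inl (inv\<^bsub>G\<^esub> x), Inl x], [Inl (inv\<^bsub>G\<^esub> x \<otimes>\<^bsub>G\<^esub> x)]) \<in> rel"
      using assms by (intro amalg_rel.mult_left) auto
    moreover have "([Inl (inv\<^bsub>G\<^esub> x \<otimes>\<^bsub>G\<^esub> x)], []) \<in> rel"
      using Inl assms amalg_rel.one_left[of G H A \<phi>] by auto
    ultimately show ?thesis
      using cls_eqI[OF amalg_rel.trans] Inl unfolding letter_inv_def by (metis sum.case(1))
  next
    case (Inr x)
    then have "([Inr (inv\<^bsub>H\<^esub> x), Inr x], [Inr (inv\<^bsub>H\<^esub> x \<otimes>\<^bsub>H\<^esub> x)]) \<in> rel"
      using assms by (intro amalg_rel.mult_right) auto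
    moreover have "([Inr (inv\<^bsub>H\<^esub> x \<otimes>\<^bsub>H\<^esub> x)], []) \<in> rel"
      using Inr assms amalg_rel.one_right[of H G A \<phi>] by auto
    ultimately show ?thesis
      using cls_eqI[OF amalg_rel.trans] Inr unfolding letter_inv_def by (metis sum.case(2))
  qed
qed

lemma left_inverse_word:
  assumes "u \<in> W"
  shows "\<exists>v\<in>W. cls (v @ u) = cls []"
  using assms
proof (induction u)
  case Nil
  then show ?case by (intro bexI[of _ "[]"]) simp_all
next
  case (Cons l u)
  then obtain v where v: "v \<in> W" "cls (v @ u) = cls []" by auto
  have l: "l \<in> carrier G <+> carrier H" and u: "u \<in> W" using Cons by simp_all
  have "cls ((v @ [letter_inv l, l]) @ u) = cls ((v @ []) @ u)"
    using v u l letter_inv[OF l] by (intro cls_append_cong) simp_all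
  then show ?case using v letter_inv(1)[OF l] by (intro bexI[of _ "v @ [letter_inv l]"]) simp_all
qed

lemma P_group: "group P"
proof (rule groupI)
  show "\<exists>y\<in>carrier P. y \<otimes>\<^bsub>P\<^esub> x = \<one>\<^bsub>P\<^esub>" if x: "x \<in> carrier P" for x
  proof -
    obtain u where u: "u \<in> W" "x = cls u" using x by (auto simp: P_carrier)
    obtain v where v: "v \<in> W" "cls (v @ u) = cls []" using left_inverse_word[OF u(1)] by blast
    show ?thesis
      by (rule bexI[of _ "cls v"]) (use u v in \<open>auto simp: P_carrier P_one P_mult\<close>)
  qed
qed (auto simp: P_carrier P_one P_mult)

definition \<iota>G :: "'a \<Rightarrow> ('a + 'b) list set" where "\<iota>G x = cls [Inl x]"
definition \<iota>H :: "'b \<Rightarrow> ('a + 'b) list set" where "\<iota>H y = cls [Inr y]"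

lemma \<iota>_hom: "\<iota>G \<in> hom G P" "\<iota>H \<in> hom H P"
proof -
  show "\<iota>G \<in> hom G P"
  proof (rule homI)
    show "\<iota>G x \<in> carrier P" if "x \<in> carrier G" for x using that by (auto simp: \<iota>G_def P_carrier)
    show "\<iota>G (x \<otimes>\<^bsub>G\<^esub> y) = \<iota>G x \<otimes>\<^bsub>P\<^esub> \<iota>G y" if "x \<in> carrier G" "y \<in> carrier G" for x y
      using that cls_eqI[OF amalg_rel.mult_left[of x G y H A \<phi>]] by (simp add: \<iota>G_def P_mult InlI)
  qed
  show "\<iota>H \<in> hom H P"
  proof (rule homI)
    show "\<iota>H x \<in> carrier P" if "x \<in> carrier H" for x using that by (auto simp: \<iota>H_def P_carrier)
    show "\<iota>H (x \<otimes>\<^bsub>H\<^esub> y) = \<iota>H x \<otimes>\<^bsub>P\<^esub> \<iota>H y" if "x \<in> carrier H" "y \<in> carrier H" for x y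
      using that cls_eqI[OF amalg_rel.mult_right[of x H y G A \<phi>]] by (simp add: \<iota>H_def P_mult InrI)
  qed
qed

definition base :: "'a \<times> ('a + 'b) list" where "base = (\<one>\<^bsub>G\<^esub>, [])"

lemma base_state: "base \<in> states"
  using subgroup.one_closed[OF A_subgroup] by (auto simp: base_def states_def intro: exI[of _ "[]"])

lemma cls_acts: "cls u = cls v \<Longrightarrow> v \<in> W \<Longrightarrow> acts u base = acts v base"
  using rel_acts[OF cls_eqD base_state] .

lemma \<iota>G_inj: "inj_on \<iota>G (carrier G)"
proof (rule inj_onI)
  fix x y assume "x \<in> carrier G" "y \<in> carrier G" "\<iota>G x = \<iota>G y"
  then show "x = y"
    using cls_acts[of "[Inl x]" "[Inl y]"] L.act_injective_at_base[of x y]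
    by (simp add: \<iota>G_def act_def base_def InlI)
qed

lemma \<iota>H_inj: "inj_on \<iota>H (carrier H)"
proof (rule inj_onI)
  fix x y assume "x \<in> carrier H" "y \<in> carrier H" "\<iota>H x = \<iota>H y"
  then show "x = y"
    using cls_acts[of "[Inr x]" "[Inr y]"] R.act_injective_at_base[of x y]
    by (simp add: \<iota>H_def act_def base_def InrI)
qed

lemma \<iota>_amalg: "a \<in> A \<Longrightarrow> \<iota>G a = \<iota>H (\<phi> a)"
  using cls_eqI[OF amalg_rel.amalg] by (simp add: \<iota>G_def \<iota>H_def)

lemma acts_A: "a \<in> A \<Longrightarrow> acts [Inl a] base = (a, [])"
  using L.act_j[of a "\<one>\<^bsub>G\<^esub>" "[]"] base_state A_closed by (simp add: act_def base_def L_states)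

lemma acts_outside:
  assumes l: "l \<in> (if i then Inl ` (carrier G - A) else Inr ` (carrier H - \<phi> ` A))"
    and "c \<in> A" "rests (\<not> i) ls"
  shows "\<exists>c'\<in>A. \<exists>l'. act l (c, ls) = (c', l' # ls) \<and> l' \<in> rest_letters i"
proof (cases i)
  case True
  then obtain x where x: "l = Inl x" "x \<in> carrier G" "x \<notin> A" using l by auto
  have "c \<in> carrier (G\<lparr>carrier := A\<rparr>)" "ls \<in> Collect (rests False)" using assms(2,3) True by simp_all
  from L.act_extends[OF x(2) _ this] obtain c' r where r: "c' \<in> A"
    "r \<in> L.rep ` carrier G - {\<one>\<^bsub>G\<^esub>}" "L.act x (c, ls) = (c', Inl r # ls)"
    using x(3) by (auto simp: L_D)
  then have "act l (c, ls) = (c', Inl r # ls)" "Inl r \<in> rest_letters i"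
    using x(1) True by (simp_all add: act_def rest_letters_L)
  then show ?thesis using r(1) by blast
next
  case False
  then obtain x where x: "l = Inr x" "x \<in> carrier H" "x \<notin> \<phi> ` A" using l by auto
  have "c \<in> carrier (G\<lparr>carrier := A\<rparr>)" "ls \<in> Collect (rests True)" using assms(2,3) False by simp_all
  from R.act_extends[OF x(2) _ this] obtain c' r where r: "c' \<in> A"
    "r \<in> R.rep ` carrier H - {\<one>\<^bsub>H\<^esub>}" "R.act x (c, ls) = (c', Inr r # ls)"
    using x(3) by (auto simp: R_D)
  then have "act l (c, ls) = (c', Inr r # ls)" "Inr r \<in> rest_letters i"
    using x(1) False by (simp_all add: act_def rest_letters_R)
  then show ?thesis using r(1) by blast
qed

definition factor :: "bool \<Rightarrow> ('a + 'b) list set set" where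
  "factor i = (if i then \<iota>G ` carrier G else \<iota>H ` carrier H)"

sublocale two_factors P factor
proof (intro two_factors.intro two_factors_axioms.intro P_group)
  interpret hG: group_hom G P \<iota>G
    using \<iota>_hom(1) P_group G.is_group by (simp add: group_hom_def group_hom_axioms_def)
  interpret hH: group_hom H P \<iota>H
    using \<iota>_hom(2) P_group H.is_group by (simp add: group_hom_def group_hom_axioms_def)
  show "subgroup (factor i) P" for i
    using hG.img_is_subgroup hH.img_is_subgroup by (simp add: factor_def)
qed

lemma C_eq: "C = \<iota>G ` A"
proof (intro equalityI subsetI)
  fix z assume "z \<in> C"
  then obtain x y where x: "x \<in> carrier G" "z = \<iota>G x" and y: "y \<in> carrier H" "z = \<iota>H y"
    by (auto simp: C_def factor_def)
  have eq: "acts [Inl x] base = acts [Inr y] base"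
    using cls_acts[of "[Inl x]" "[Inr y]"] x y by (simp add: \<iota>G_def \<iota>H_def InrI)
  have "x \<in> A"
  proof (rule ccontr)
    assume "x \<notin> A"
    then obtain c l where 1: "acts [Inl x] base = (c, [l])" "l \<in> rest_letters True"
      using acts_outside[of "Inl x" True "\<one>\<^bsub>G\<^esub>" "[]"] x subgroup.one_closed[OF A_subgroup]
      by (auto simp: base_def)
    show False
    proof (cases "y \<in> \<phi> ` A")
      case True
      then obtain a where "a \<in> A" "z = \<iota>G a" using \<iota>_amalg y by auto
      then have "x = a" using x \<iota>G_inj A_closed by (auto dest: inj_onD)
      then show False using \<open>a \<in> A\<close> \<open>x \<notin> A\<close> by simp
    next
      case False
      then obtain c' l' where "acts [Inr y] base = (c', [l'])" "l' \<in> rest_letters False"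
        using acts_outside[of "Inr y" False "\<one>\<^bsub>G\<^esub>" "[]"] y subgroup.one_closed[OF A_subgroup]
        by (auto simp: base_def)
      then show False using 1 eq by (auto simp: rest_letters_def)
    qed
  qed
  then show "z \<in> \<iota>G ` A" using x by blast
next
  fix z assume "z \<in> \<iota>G ` A"
  then obtain a where "a \<in> A" "z = \<iota>G a" by blast
  then have "z \<in> \<iota>G ` carrier G" "z \<in> \<iota>H ` carrier H" using A_closed \<phi>_closed \<iota>_amalg by blast+
  then show "z \<in> C" by (simp add: C_def factor_def)
qed

lemma factor_diff_C:
  assumes "z \<in> factor i - C"
  obtains l where "l \<in> (if i then Inl ` (carrier G - A) else Inr ` (carrier H - \<phi> ` A))" "z = cls [l]"
proof (cases i)
  case True
  then obtain x where x: "x \<in> carrier G" "z = \<iota>G x" using assms by (auto simp: factor_def)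
  then have "x \<notin> A" using assms by (auto simp: C_eq)
  then show thesis using that[of "Inl x"] x True by (auto simp: \<iota>G_def)
next
  case False
  then obtain x where x: "x \<in> carrier H" "z = \<iota>H x" using assms by (auto simp: factor_def)
  then have "x \<notin> \<phi> ` A" using assms \<iota>_amalg by (auto simp: C_eq)
  then show thesis using that[of "Inr x"] x False by (auto simp: \<iota>H_def)
qed

lemma reduced_acts:
  assumes "reduced i zs"
  shows "\<exists>u\<in>W. wprod zs = cls u \<and> (\<exists>c\<in>A. \<exists>ls. acts u base = (c, ls) \<and> rests i ls \<and> length ls = length zs)"
  using assms
proof (induction zs arbitrary: i)
  case Nil
  then show ?case
    using subgroup.one_closed[OF A_subgroup] by (intro bexI[of _ "[]"]) (auto simp: base_def P_one)
next
  case (Cons z zs)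
  then obtain u c ls where u: "u \<in> W" "wprod zs = cls u" "c \<in> A" "acts u base = (c, ls)"
    "rests (\<not> i) ls" "length ls = length zs" by (auto dest!: Cons.IH)
  obtain l where l: "l \<in> (if i then Inl ` (carrier G - A) else Inr ` (carrier H - \<phi> ` A))" "z = cls [l]"
    using factor_diff_C Cons.prems by auto
  then have lc: "l \<in> carrier G <+> carrier H" by (auto split: if_splits)
  obtain c' l' where l': "c' \<in> A" "act l (c, ls) = (c', l' # ls)" "l' \<in> rest_letters i"
    using acts_outside[OF l(1) u(3,5)] by blast
  have "wprod (z # zs) = cls (l # u)" using P_mult[of "[l]" u] u l lc by simp
  then show ?case
    using u l' lc by (intro bexI[of _ "l # u"] conjI bexI[of _ c'] exI[of _ "l' # ls"]) simp_all
qed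

sublocale amalgam P factor
proof (intro amalgam.intro two_factors_axioms amalgam_axioms.intro)
  show "wprod zs \<notin> C" if zs: "reduced i zs" "zs \<noteq> []" for i zs
  proof
    assume "wprod zs \<in> C"
    then obtain a where a: "a \<in> A" "wprod zs = cls [Inl a]" by (auto simp: C_eq \<iota>G_def)
    obtain u c ls where u: "u \<in> W" "wprod zs = cls u" "acts u base = (c, ls)" "length ls = length zs"
      using reduced_acts[OF zs(1)] by blast
    have "acts u base = acts [Inl a] base"
      using cls_acts[of u "[Inl a]"] a u A_closed by (simp add: InlI)
    then show False using u(3,4) acts_A[OF a(1)] zs(2) by simp
  qed
  show "\<exists>zs. set zs \<subseteq> factor True \<union> factor False \<and> x = wprod zs" if x: "x \<in> carrier P" for x
  proof -
    obtain u where "u \<in> W" "x = cls u" using x by (auto simp: P_carrier)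
    have "set (map (\<lambda>l. cls [l]) u) \<subseteq> factor True \<union> factor False \<and> cls u = wprod (map (\<lambda>l. cls [l]) u)"
      if "u \<in> W" for u
      using that
    proof (induction u)
      case (Cons l u)
      then have "cls [l] \<in> factor True \<union> factor False" by (auto simp: factor_def \<iota>G_def \<iota>H_def)
      moreover have "cls (l # u) = cls [l] \<otimes>\<^bsub>P\<^esub> cls u" using P_mult[of "[l]" u] Cons.prems by simp
      ultimately show ?case using Cons by simp
    qed (simp add: P_one)
    then show ?thesis using \<open>u \<in> W\<close> \<open>x = cls u\<close> by blast
  qed
qed

end


section \<open>Amalgamated products of CSA-groups\<close>

text \<open>Apart from its relativisation to \<open>S\<close>, the elementwise condition mentions only products and inverses
  of elements of \<open>S\<close>, which an embedding preserves and reflects.\<close>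

lemma csa_at_image:
  assumes "group G" "group P" "f \<in> hom G P" "inj_on f (carrier G)"
    and a: "a \<in> carrier G" and csa: "csa_at G (carrier G) a"
  shows "csa_at P (f ` carrier G) (f a)"
proof -
  interpret group_hom G P f using assms by (simp add: group_hom_def group_hom_axioms_def)
  have commute_iff: "commute P (f x) (f y) \<longleftrightarrow> commute G x y" if "x \<in> carrier G" "y \<in> carrier G" for x y
  proof -
    have "commute P (f x) (f y) \<longleftrightarrow> f (x \<otimes>\<^bsub>G\<^esub> y) = f (y \<otimes>\<^bsub>G\<^esub> x)"
      unfolding commute_def using that by simp
    also have "\<dots> \<longleftrightarrow> x \<otimes>\<^bsub>G\<^esub> y = y \<otimes>\<^bsub>G\<^esub> x"
      by (rule inj_on_eq_iff[OF assms(4)]) (use that in simp_all)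
    finally show ?thesis unfolding commute_def .
  qed
  have conj: "f g \<otimes>\<^bsub>P\<^esub> (f a \<otimes>\<^bsub>P\<^esub> inv\<^bsub>P\<^esub> f g) = f (g \<otimes>\<^bsub>G\<^esub> (a \<otimes>\<^bsub>G\<^esub> inv\<^bsub>G\<^esub> g))"
    if "g \<in> carrier G" for g
    using that a by simp
  show ?thesis
    unfolding csa_at_def ball_simps
  proof (intro conjI ballI impI)
    fix x y assume "x \<in> carrier G" "y \<in> carrier G" "commute P (f a) (f x)" "commute P (f a) (f y)"
    then show "commute P (f x) (f y)" using csa commute_iff a unfolding csa_at_def by blast
  next
    fix g assume g: "g \<in> carrier G" "commute P (f a) (f g \<otimes>\<^bsub>P\<^esub> (f a \<otimes>\<^bsub>P\<^esub> inv\<^bsub>P\<^esub> f g))"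
    then have "commute G a (g \<otimes>\<^bsub>G\<^esub> (a \<otimes>\<^bsub>G\<^esub> inv\<^bsub>G\<^esub> g))"
      using conj[OF g(1)] commute_iff[of a "g \<otimes>\<^bsub>G\<^esub> (a \<otimes>\<^bsub>G\<^esub> inv\<^bsub>G\<^esub> g)"] a by (metis G.inv_closed G.m_closed)
    then show "commute P (f a) (f g)" using csa commute_iff[OF a g(1)] g(1) unfolding csa_at_def by blast
  qed
qed

theorem theorem2:
  fixes G :: "('a, 'm) monoid_scheme" and H :: "('b, 'n) monoid_scheme"
    and A :: "'a set" and B :: "'b set" and \<phi> :: "'a \<Rightarrow> 'b"
  assumes "CSA_star_group G" and "CSA_star_group H"
    and "subgroup A G" and "subgroup B H"
    and "A = mal_closure G A"
    and "B \<lhd> H\<lparr>carrier := mal_closure H B\<rparr>"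
    and "\<phi> \<in> iso (G\<lparr>carrier := A\<rparr>) (H\<lparr>carrier := B\<rparr>)"
  shows "CSA_star_group (amalgamated_product G H A \<phi>)"
proof -
  interpret G: group G using assms(1) by (simp add: CSA_star_group_def CSA_group_def)
  interpret H: group H using assms(2) by (simp add: CSA_star_group_def CSA_group_def)
  have B: "B \<subseteq> carrier H" using assms(4) by (simp add: subgroup_def)
  interpret amalgam_data G H A \<phi>
  proof (intro amalgam_data.intro amalgam_data_axioms.intro G.is_group H.is_group assms(3))
    show "\<phi> \<in> hom (G\<lparr>carrier := A\<rparr>) H" using assms(7) B by (auto simp: iso_def hom_def)
    show "inj_on \<phi> A" using assms(7) by (auto simp: iso_def bij_betw_def)
  qed
  have "malnormal A G" using G.malnormal_mal_closure[of A] A_closed assms(5) by auto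
  interpret malnormal_amalgam P factor
  proof (intro malnormal_amalgam.intro malnormal_amalgam_axioms.intro amalgam_axioms)
    fix c g assume c: "c \<in> C" and g: "g \<in> factor True - C" and conj: "inv\<^bsub>P\<^esub> g \<otimes>\<^bsub>P\<^esub> (c \<otimes>\<^bsub>P\<^esub> g) \<in> C"
    interpret \<iota>: group_hom G P \<iota>G
      using \<iota>_hom(1) P_group by (simp add: group_hom_def group_hom_axioms_def G.is_group)
    obtain a where a: "a \<in> A" "c = \<iota>G a" using c by (auto simp: C_eq)
    obtain x where x: "x \<in> carrier G" "g = \<iota>G x" using g by (auto simp: factor_def)
    have "x \<notin> A" using g x by (auto simp: C_eq)
    define b where "b = inv\<^bsub>G\<^esub> x \<otimes>\<^bsub>G\<^esub> (a \<otimes>\<^bsub>G\<^esub> x)"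
    have b: "b \<in> carrier G" using x a A_closed by (simp add: b_def)
    have "\<iota>G b \<in> \<iota>G ` A" using conj x a A_closed by (simp add: b_def C_eq)
    then have "b \<in> A" using inj_on_image_mem_iff[OF \<iota>G_inj b] A_closed by blast
    then have "a = \<one>\<^bsub>G\<^esub>"
      using G.malnormalD[OF \<open>malnormal A G\<close> x(1) a(1)] \<open>x \<notin> A\<close> by (auto simp: b_def)
    then show "c = \<one>\<^bsub>P\<^esub>" using a by simp
  qed
  have csa_G: "csa_at G (carrier G) x" if "x \<in> carrier G" "x \<noteq> \<one>\<^bsub>G\<^esub>" for x
    using G.CSA_group_imp_csa_at assms(1) that by (simp add: CSA_star_group_def)
  have csa_H: "csa_at H (carrier H) x" if "x \<in> carrier H" "x \<noteq> \<one>\<^bsub>H\<^esub>" for x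
    using H.CSA_group_imp_csa_at assms(2) that by (simp add: CSA_star_group_def)
  have one: "\<iota>G \<one>\<^bsub>G\<^esub> = \<one>\<^bsub>P\<^esub>" "\<iota>H \<one>\<^bsub>H\<^esub> = \<one>\<^bsub>P\<^esub>"
    using hom_one[OF \<iota>_hom(1) G.is_group P_group] hom_one[OF \<iota>_hom(2) H.is_group P_group] by auto
  show ?thesis
  proof (rule CSA_star_group_if_factors)
    fix f z assume z: "z \<in> factor f" "z \<noteq> \<one>\<^bsub>P\<^esub>"
    show "csa_at P (factor f) z"
    proof (cases f)
      case True
      then obtain x where "x \<in> carrier G" "z = \<iota>G x" using z by (auto simp: factor_def)
      then show ?thesis
        using csa_at_image[OF G.is_group P_group \<iota>_hom(1) \<iota>G_inj _ csa_G] z one True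
        by (auto simp: factor_def)
    next
      case False
      then obtain x where "x \<in> carrier H" "z = \<iota>H x" using z by (auto simp: factor_def)
      then show ?thesis
        using csa_at_image[OF H.is_group P_group \<iota>_hom(2) \<iota>H_inj _ csa_H] z one False
        by (auto simp: factor_def)
    qed
  next
    fix f z assume z: "z \<in> factor f" "z \<otimes>\<^bsub>P\<^esub> z = \<one>\<^bsub>P\<^esub>"
    show "z = \<one>\<^bsub>P\<^esub>"
    proof (cases f)
      case True
      then obtain x where x: "x \<in> carrier G" "z = \<iota>G x" using z by (auto simp: factor_def)
      then have "\<iota>G (x \<otimes>\<^bsub>G\<^esub> x) = \<iota>G \<one>\<^bsub>G\<^esub>" using z hom_mult[OF \<iota>_hom(1)] one by simp
      then have "x \<otimes>\<^bsub>G\<^esub> x = \<one>\<^bsub>G\<^esub>" using inj_onD[OF \<iota>G_inj] x by blast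
      then show ?thesis
        using assms(1) G.ord_eq_2_iff[OF x(1)] x one by (auto simp: CSA_star_group_def)
    next
      case False
      then obtain x where x: "x \<in> carrier H" "z = \<iota>H x" using z by (auto simp: factor_def)
      then have "\<iota>H (x \<otimes>\<^bsub>H\<^esub> x) = \<iota>H \<one>\<^bsub>H\<^esub>" using z hom_mult[OF \<iota>_hom(2)] one by simp
      then have "x \<otimes>\<^bsub>H\<^esub> x = \<one>\<^bsub>H\<^esub>" using inj_onD[OF \<iota>H_inj] x by blast
      then show ?thesis
        using assms(2) H.ord_eq_2_iff[OF x(1)] x one by (auto simp: CSA_star_group_def)
    qed
  qed
qed

end
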